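(* Let $u$ be a quasi-definite linear functional (for instance a Borel measure) in one variable, with monic orthogonal polynomials $P=(P_0,P_1,\dots)^\top$, second kind functions $C=(C_0,C_1,\dots)^\top$ and Jacobi matrix $J$. Then $$JP(x)=xP(x),\qquad JC(x)=xC(x)-H_0\boldsymbol e_0,$$ where $\boldsymbol e_0=(1,0,0,\dots)^\top$ (the second identity for $x\notin\operatorname{supp}(u)$). That is, for $k\ge1$, $$\frac{H_k}{H_{k-1}}P_{k-1}+(S_{k,k-1}-S_{k+1,k})P_k+P_{k+1}=xP_k,$$ $$\frac{H_k}{H_{k-1}}C_{k-1}+(S_{k,k-1}-S_{k+1,k})C_k+C_{k+1}=xC_k.$$
   Context: $u$ is a complex Borel measure on $\mathbb{R}$ with finite absolute moments, or more generally a distribution in $\mathcal O_c'(\mathbb{R})$; $u(f)$ denotes its action ($\int f\,d\mu$ for a measure). The bilinear form is $\langle P,Q\rangle_u=u(PQ)$ and the moment matrix is the Hankel matrix $G_{i,j}=u(x^{i+j})$, $i,j\ge0$. Quasi-definite means that all leading principal minors of $G$ are nonzero; then uniquely $G=S^{-1}HS^{-\top}$ with $S$ lower unitriangular and $H=\operatorname{diag}(H_0,H_1,\dots)$. With $\chi(x)=(1,x,x^2,\dots)^\top$, $P=S\chi$; $P_k$ is monic of degree $k$. The second kind functions are $C_k(z)=u\big(P_k(x)/(z-x)\big)$, $z\notin\operatorname{supp}(u)$. $\Lambda$ is the shift matrix $\Lambda_{i,j}=\delta_{i+1,j}$ and $J=S\Lambda S^{-1}$. *)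

theory Defs
  imports "HOL-Analysis.Analysis" "Jordan_Normal_Form.Determinant"
begin

definition complex_measure :: "(real set \<Rightarrow> complex) \<Rightarrow> bool" where
  "complex_measure \<mu> \<longleftrightarrow>
     (\<forall>A :: nat \<Rightarrow> real set. range A \<subseteq> sets borel \<longrightarrow> disjoint_family A \<longrightarrow>
        (\<lambda>i. \<mu> (A i)) sums \<mu> (\<Union>i. A i))"

(* The positive part in the Jordan decomposition of a real signed measure:
   nu+(A) is the supremum of nu(B) over Borel sets B contained in A.
   (ennreal sends negative numbers to 0, and B may be empty.) *)
definition upper_variation :: "(real set \<Rightarrow> real) \<Rightarrow> real measure" where
  "upper_variation \<nu> =
     measure_of UNIV (sets borel) (\<lambda>A. SUP B\<in>{B \<in> sets borel. B \<subseteq> A}. ennreal (\<nu> B))"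

abbreviation (input) "re_pos \<mu> \<equiv> upper_variation (\<lambda>A. Re (\<mu> A))"
abbreviation (input) "re_neg \<mu> \<equiv> upper_variation (\<lambda>A. - Re (\<mu> A))"
abbreviation (input) "im_pos \<mu> \<equiv> upper_variation (\<lambda>A. Im (\<mu> A))"
abbreviation (input) "im_neg \<mu> \<equiv> upper_variation (\<lambda>A. - Im (\<mu> A))"

(* Equivalent to integrability with respect to the total variation, which lies between one half of
   the sum of the four measures and that sum. *)
definition cm_integrable :: "(real set \<Rightarrow> complex) \<Rightarrow> (real \<Rightarrow> complex) \<Rightarrow> bool" where
  "cm_integrable \<mu> f \<longleftrightarrow>
     integrable (re_pos \<mu>) f \<and> integrable (re_neg \<mu>) f \<and>
     integrable (im_pos \<mu>) f \<and> integrable (im_neg \<mu>) f"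

definition cm_integral :: "(real set \<Rightarrow> complex) \<Rightarrow> (real \<Rightarrow> complex) \<Rightarrow> complex" where
  "cm_integral \<mu> f =
     (integral\<^sup>L (re_pos \<mu>) f - integral\<^sup>L (re_neg \<mu>) f) +
     \<i> * (integral\<^sup>L (im_pos \<mu>) f - integral\<^sup>L (im_neg \<mu>) f)"

definition finite_absolute_moments :: "(real set \<Rightarrow> complex) \<Rightarrow> bool" where
  "finite_absolute_moments \<mu> \<longleftrightarrow> (\<forall>n. cm_integrable \<mu> (\<lambda>x. complex_of_real (\<bar>x\<bar> ^ n)))"

definition measure_support :: "(real set \<Rightarrow> complex) \<Rightarrow> real set" where
  "measure_support \<mu> =
     {x. \<forall>U. open U \<longrightarrow> x \<in> U \<longrightarrow> (\<exists>A\<in>sets borel. A \<subseteq> U \<and> \<mu> A \<noteq> 0)}"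

definition nth_deriv :: "nat \<Rightarrow> (real \<Rightarrow> complex) \<Rightarrow> real \<Rightarrow> complex" where
  "nth_deriv j = (\<lambda>f x. vector_derivative f (at x)) ^^ j"

definition smooth :: "(real \<Rightarrow> complex) \<Rightarrow> bool" where
  "smooth f \<longleftrightarrow> (\<forall>j x. nth_deriv j f differentiable (at x))"

(* Smooth functions all of whose derivatives grow at most like (1 + x^2)^k.  The space O_c is the
   union over k of these Frechet spaces (the same k serves for all derivatives), with the inductive
   limit topology. *)
definition Oc_level :: "nat \<Rightarrow> (real \<Rightarrow> complex) set" where
  "Oc_level k =
     {f. smooth f \<and> (\<forall>j. \<exists>B. \<forall>x. cmod (nth_deriv j f x) \<le> B * (1 + x\<^sup>2) ^ k)}"

definition Oc :: "(real \<Rightarrow> complex) set" where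
  "Oc = (\<Union>k. Oc_level k)"

(* A linear form on an inductive limit is continuous iff its restriction to every step is; the last
   conjunct says that on step k it is dominated by one of the seminorms
   max over j <= m of sup over x of |f^(j)(x)| / (1 + x^2)^k.  The values of T outside Oc are
   irrelevant. *)
definition Oc_dual :: "((real \<Rightarrow> complex) \<Rightarrow> complex) \<Rightarrow> bool" where
  "Oc_dual T \<longleftrightarrow>
     (\<forall>f\<in>Oc. \<forall>g\<in>Oc. T (\<lambda>x. f x + g x) = T f + T g) \<and>
     (\<forall>f\<in>Oc. \<forall>a. T (\<lambda>x. a * f x) = a * T f) \<and>
     (\<forall>k. \<exists>m B. \<forall>f\<in>Oc_level k. \<forall>c.
        (\<forall>j\<le>m. \<forall>x. cmod (nth_deriv j f x) \<le> c * (1 + x\<^sup>2) ^ k) \<longrightarrow> cmod (T f) \<le> B * c)"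

definition test_functions :: "real set \<Rightarrow> (real \<Rightarrow> complex) set" where
  "test_functions U =
     {\<phi>. smooth \<phi> \<and> compact (closure {x. \<phi> x \<noteq> 0}) \<and> closure {x. \<phi> x \<noteq> 0} \<subseteq> U}"

definition distribution_support :: "((real \<Rightarrow> complex) \<Rightarrow> complex) \<Rightarrow> real set" where
  "distribution_support T =
     {x. \<forall>U. open U \<longrightarrow> x \<in> U \<longrightarrow> (\<exists>\<phi>\<in>test_functions U. T \<phi> \<noteq> 0)}"

(* T acts on every f that coincides near its support with an element g of Oc, and T g does not
   depend on the choice of g.  This is needed for f x = P x / (z - x) when z is a real point outside
   the support; on Oc itself the action is T. *)
definition distribution_action :: "((real \<Rightarrow> complex) \<Rightarrow> complex) \<Rightarrow> (real \<Rightarrow> complex) \<Rightarrow> complex"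
  where
  "distribution_action T f =
     (THE c. \<exists>g\<in>Oc. (\<exists>U. open U \<and> distribution_support T \<subseteq> U \<and> (\<forall>x\<in>U. g x = f x)) \<and> c = T g)"

datatype functional =
    Measure "real set \<Rightarrow> complex"
  | Distribution "(real \<Rightarrow> complex) \<Rightarrow> complex"

fun admissible :: "functional \<Rightarrow> bool" where
  "admissible (Measure \<mu>) \<longleftrightarrow> complex_measure \<mu> \<and> finite_absolute_moments \<mu>"
| "admissible (Distribution T) \<longleftrightarrow> Oc_dual T"

fun action :: "functional \<Rightarrow> (real \<Rightarrow> complex) \<Rightarrow> complex" where
  "action (Measure \<mu>) = cm_integral \<mu>"
| "action (Distribution T) = distribution_action T"

fun supp :: "functional \<Rightarrow> real set" where
  "supp (Measure \<mu>) = measure_support \<mu>"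
| "supp (Distribution T) = distribution_support T"

type_synonym imat = "nat \<Rightarrow> nat \<Rightarrow> complex"
type_synonym ivec = "nat \<Rightarrow> complex"

(* In all products below the rows of the left factor are finitely supported, so that the series are
   finite sums. *)
definition imat_mult :: "imat \<Rightarrow> imat \<Rightarrow> imat" (infixl "\<odot>" 70) where
  "A \<odot> B = (\<lambda>i j. \<Sum>k. A i k * B k j)"

definition imat_vec :: "imat \<Rightarrow> ivec \<Rightarrow> ivec" (infixr "\<odot>\<^sub>v" 70) where
  "A \<odot>\<^sub>v v = (\<lambda>i. \<Sum>k. A i k * v k)"

definition diag :: "ivec \<Rightarrow> imat" where
  "diag h = (\<lambda>i j. if i = j then h i else 0)"

definition imat_transpose :: "imat \<Rightarrow> imat" where
  "imat_transpose A = (\<lambda>i j. A j i)"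

definition lower_unitriangular :: "imat \<Rightarrow> bool" where
  "lower_unitriangular A \<longleftrightarrow> (\<forall>i. A i i = 1) \<and> (\<forall>i j. i < j \<longrightarrow> A i j = 0)"

definition lower_inv :: "imat \<Rightarrow> imat" where
  "lower_inv A =
     (THE B. lower_unitriangular B \<and> A \<odot> B = diag (\<lambda>_. 1) \<and> B \<odot> A = diag (\<lambda>_. 1))"

definition shift :: imat where
  "shift = (\<lambda>i j. if j = i + 1 then 1 else 0)"

definition e0 :: ivec where
  "e0 = (\<lambda>i. if i = 0 then 1 else 0)"

definition monomials :: "complex \<Rightarrow> ivec" where
  "monomials x = (\<lambda>j. x ^ j)"

definition moment_matrix :: "functional \<Rightarrow> imat" where
  "moment_matrix u = (\<lambda>i j. action u (\<lambda>x. complex_of_real x ^ (i + j)))"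

definition quasi_definite :: "functional \<Rightarrow> bool" where
  "quasi_definite u \<longleftrightarrow>
     (\<forall>n\<ge>1. Determinant.det (Matrix.mat n n (\<lambda>(i, j). moment_matrix u i j)) \<noteq> 0)"

definition gauss_borel :: "imat \<Rightarrow> imat \<Rightarrow> ivec \<Rightarrow> bool" where
  "gauss_borel G S h \<longleftrightarrow>
     lower_unitriangular S \<and> G = lower_inv S \<odot> diag h \<odot> imat_transpose (lower_inv S)"

definition gauss_borel_factors :: "functional \<Rightarrow> imat \<times> ivec" where
  "gauss_borel_factors u = (THE (S, h). gauss_borel (moment_matrix u) S h)"

definition S_mat :: "functional \<Rightarrow> imat" where
  "S_mat u = fst (gauss_borel_factors u)"

definition H_diag :: "functional \<Rightarrow> ivec" where
  "H_diag u = snd (gauss_borel_factors u)"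

definition orth_poly :: "functional \<Rightarrow> complex \<Rightarrow> ivec" where
  "orth_poly u x = S_mat u \<odot>\<^sub>v monomials x"

definition second_kind :: "functional \<Rightarrow> complex \<Rightarrow> ivec" where
  "second_kind u z =
     (\<lambda>k. action u (\<lambda>x. orth_poly u (complex_of_real x) k / (z - complex_of_real x)))"

definition jacobi :: "functional \<Rightarrow> imat" where
  "jacobi u = S_mat u \<odot> shift \<odot> lower_inv (S_mat u)"

end

theory Submission
  imports Defs
begin

text \<open>
  Write $L = S^{-1}$, so that $J = S \Lambda L$, and put $P = S\chi$. Since
  $\Lambda \chi(x) = x \chi(x)$, one gets $JP(x) = S \Lambda \chi(x) = x P(x)$.

  The second kind functions have the same shape. For $z$ outside the support let
  $R_j(z) = u(x^j / (z - x))$. Linearity gives $C(z) = S R(z)$, and the identity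
  $x^{j+1} / (z - x) = z\, x^j / (z - x) - x^j$ gives $\Lambda R(z) = z R(z) - m$, where $m$ is the
  vector of moments, that is, the first column of $G$. Hence
  $JC(z) = S \Lambda R(z) = z\, C(z) - S m$, and $S G = H L^\top$ shows that
  $S m = H_0 e_0$: the inhomogeneous term is the orthogonality of $P_k$ to the constants.

  The scalar relations follow because $J$ is tridiagonal. It has one superdiagonal because $S$ is
  lower unitriangular. It has one subdiagonal because $J H = S (\Lambda G) S^\top$ is symmetric,
  which is where the Hankel structure of $G$ enters; the same symmetry, with
  $J_{k,k+1} = 1$, gives $J_{k,k-1} = H_k / H_{k-1}$, and the diagonal is read off from
  $J S = S \Lambda$. Dividing by $H_{k-1}$ requires that no $H_k$ vanishes, which is
  the content of quasi-definiteness (lemma \<open>gauss_borel_diagonal_nonzero\<close>). All of this presupposes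
  that the factorization exists and is unique (lemmas \<open>gauss_borel_exists\<close> and
  \<open>gauss_borel_unique\<close>).

  The analytic part consists of the two identities used above for the action of $u$ on the
  functions $x^j / (z - x)$ (lemma \<open>action_cauchy\<close>). For a measure they hold because
  $1 / (z - x)$ is bounded almost everywhere when $z$ is outside the support, so that all functions
  involved are integrable.
  For a distribution the action on such a function is defined through an extension from a
  neighbourhood of the support to an element of $\mathcal O_c$. An extension exists: for real $z$
  multiply $1 / (z - x)$ by a smooth function that vanishes near $z$ and is one near the support; for
  nonreal $z$ the function itself is in $\mathcal O_c$. The value does not depend on it,
  because $T$ annihilates every $h \in \mathcal O_c$ that vanishes near the support
  (lemma \<open>Oc_dual_vanishes\<close>): a partition of unity settles compactly supported $h$, and
  cutting off at $|x| \approx n$ costs $O(n^{-2})$ by the continuity of $T$ one growth level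
  higher. Both constructions rest on a single smooth step function with bounded derivatives.
\<close>

section \<open>Row-finite infinite matrices\<close>

definition row_finite :: "imat \<Rightarrow> bool" where
  "row_finite A \<longleftrightarrow> (\<forall>i. finite {k. A i k \<noteq> 0})"

lemma imat_mult_eq_sum:
  assumes "finite K" and "\<And>k. k \<notin> K \<Longrightarrow> A i k * B k j = 0"
  shows "(A \<odot> B) i j = (\<Sum>k\<in>K. A i k * B k j)"
  unfolding imat_mult_def by (rule suminf_finite[OF assms])

text \<open>
  A vector is a matrix with constant rows, so that everything about matrix--vector products is an
  instance of a fact about matrix products.
\<close>
lemma imat_vec_eq_mult: "(A \<odot>\<^sub>v v) i = (A \<odot> (\<lambda>k _. v k)) i j"
  by (simp add: imat_vec_def imat_mult_def)

text \<open>
  Associativity amounts to exchanging two summations. It is safe as soon as, for the given entry,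
  the outer sum and the inner sums have finite support; either row-finiteness of the middle factor
  or column-finiteness of the right factor provides the latter.
\<close>
lemma imat_mult_assoc_entry:
  assumes K: "finite K" "\<And>k. k \<notin> K \<Longrightarrow> A i k = 0"
    and M: "finite M" "\<And>k m. k \<in> K \<Longrightarrow> m \<notin> M \<Longrightarrow> B k m * C m j = 0"
  shows "((A \<odot> B) \<odot> C) i j = (A \<odot> (B \<odot> C)) i j"
proof -
  have AB: "(A \<odot> B) i m = (\<Sum>k\<in>K. A i k * B k m)" for m
    by (rule imat_mult_eq_sum) (use K in auto)
  have BC: "(B \<odot> C) k j = (\<Sum>m\<in>M. B k m * C m j)" if "k \<in> K" for k
    by (rule imat_mult_eq_sum) (use M that in auto)
  have "((A \<odot> B) \<odot> C) i j = (\<Sum>m\<in>M. (A \<odot> B) i m * C m j)"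
    by (rule imat_mult_eq_sum)
       (use M in \<open>auto simp: AB sum_distrib_right mult.assoc intro!: sum.neutral\<close>)
  also have "\<dots> = (\<Sum>k\<in>K. A i k * (\<Sum>m\<in>M. B k m * C m j))"
    unfolding AB sum_distrib_right sum_distrib_left
    by (subst sum.swap) (simp add: mult.assoc)
  also have "\<dots> = (\<Sum>k\<in>K. A i k * (B \<odot> C) k j)"
    by (simp add: BC)
  also have "\<dots> = (A \<odot> (B \<odot> C)) i j"
    by (rule imat_mult_eq_sum[symmetric]) (use K in auto)
  finally show ?thesis .
qed

lemma imat_mult_assoc:
  assumes A: "row_finite A" and B: "row_finite B"
  shows "(A \<odot> B) \<odot> C = A \<odot> (B \<odot> C)"
proof (intro ext)
  fix i j
  show "((A \<odot> B) \<odot> C) i j = (A \<odot> (B \<odot> C)) i j"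
    by (rule imat_mult_assoc_entry[of "{k. A i k \<noteq> 0}" _ _ "\<Union>k\<in>{k. A i k \<noteq> 0}. {m. B k m \<noteq> 0}"])
       (use A B in \<open>auto simp: row_finite_def\<close>)
qed

lemma imat_mult_assoc_column_finite:
  assumes A: "row_finite A" and C: "row_finite (imat_transpose C)"
  shows "(A \<odot> B) \<odot> C = A \<odot> (B \<odot> C)"
proof (intro ext)
  fix i j
  show "((A \<odot> B) \<odot> C) i j = (A \<odot> (B \<odot> C)) i j"
    by (rule imat_mult_assoc_entry[of "{k. A i k \<noteq> 0}" _ _ "{m. imat_transpose C j m \<noteq> 0}"])
       (use A C in \<open>auto simp: row_finite_def imat_transpose_def\<close>)
qed

lemma imat_vec_assoc:
  assumes "row_finite A" and "row_finite B"
  shows "(A \<odot> B) \<odot>\<^sub>v v = A \<odot>\<^sub>v (B \<odot>\<^sub>v v)"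
proof
  fix i
  have "(\<lambda>k (_::nat). (B \<odot>\<^sub>v v) k) = B \<odot> (\<lambda>k _. v k)"
    by (intro ext imat_vec_eq_mult)
  then show "((A \<odot> B) \<odot>\<^sub>v v) i = (A \<odot>\<^sub>v (B \<odot>\<^sub>v v)) i"
    by (simp add: imat_vec_eq_mult[where j = 0] imat_mult_assoc[OF assms])
qed

lemma row_finite_imat_mult:
  assumes A: "row_finite A" and B: "row_finite B"
  shows "row_finite (A \<odot> B)"
  unfolding row_finite_def
proof
  fix i
  let ?K = "{k. A i k \<noteq> 0}"
  have eq: "(A \<odot> B) i m = (\<Sum>k\<in>?K. A i k * B k m)" for m
    by (rule imat_mult_eq_sum) (use A in \<open>auto simp: row_finite_def\<close>)
  have "{m. (A \<odot> B) i m \<noteq> 0} \<subseteq> (\<Union>k\<in>?K. {m. B k m \<noteq> 0})"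
    unfolding eq by (auto elim!: sum.not_neutral_contains_not_neutral)
  then show "finite {m. (A \<odot> B) i m \<noteq> 0}"
    by (rule finite_subset) (use A B in \<open>auto simp: row_finite_def\<close>)
qed

lemma diag_mult: "(diag h \<odot> A) i j = h i * A i j"
  by (subst imat_mult_eq_sum[of "{i}"]) (auto simp: diag_def)

lemma mult_diag: "(A \<odot> diag h) i j = A i j * h j"
  by (subst imat_mult_eq_sum[of "{j}"]) (auto simp: diag_def)

lemma shift_mult: "(shift \<odot> A) i j = A (i + 1) j"
  by (subst imat_mult_eq_sum[of "{i + 1}"]) (auto simp: shift_def)

lemma shift_vec: "(shift \<odot>\<^sub>v v) i = v (i + 1)"
  by (simp add: imat_vec_eq_mult[where j = 0] shift_mult)

lemma mult_shift: "(A \<odot> shift) i j = (if j = 0 then 0 else A i (j - 1))"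
  by (subst imat_mult_eq_sum[of "{j - 1}"]) (auto simp: shift_def)

lemma diag_one_mult [simp]: "diag (\<lambda>_. 1) \<odot> A = A"
  by (intro ext) (simp add: diag_mult)

lemma mult_diag_one [simp]: "A \<odot> diag (\<lambda>_. 1) = A"
  by (intro ext) (simp add: mult_diag)

lemma diag_one_vec [simp]: "diag (\<lambda>_. 1) \<odot>\<^sub>v v = v"
  by (rule ext) (simp add: imat_vec_eq_mult[where j = 0])

lemma transpose_transpose [simp]: "imat_transpose (imat_transpose A) = A"
  by (simp add: imat_transpose_def)

lemma transpose_diag [simp]: "imat_transpose (diag h) = diag h"
  by (intro ext) (simp add: imat_transpose_def diag_def)

lemma transpose_mult:
  "imat_transpose (A \<odot> B) = imat_transpose B \<odot> imat_transpose A"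
  by (simp add: imat_transpose_def imat_mult_def mult.commute)

lemma row_finite_diag [simp]: "row_finite (diag h)"
  unfolding row_finite_def
proof
  fix i show "finite {k. diag h i k \<noteq> 0}"
    by (rule finite_subset[of _ "{i}"]) (auto simp: diag_def)
qed

lemma row_finite_shift [simp]: "row_finite shift"
  unfolding row_finite_def
proof
  fix i show "finite {k. shift i k \<noteq> 0}"
    by (rule finite_subset[of _ "{i + 1}"]) (auto simp: shift_def)
qed

lemma row_finite_lower_unitriangular:
  assumes "lower_unitriangular A"
  shows "row_finite A"
  unfolding row_finite_def
proof
  fix i show "finite {k. A i k \<noteq> 0}"
    by (rule finite_subset[of _ "{..i}"]) (use assms in \<open>auto simp: lower_unitriangular_def not_le[symmetric]\<close>)
qed

lemma lower_unitriangular_mult_eq_sum: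
  assumes "lower_unitriangular A"
  shows "(A \<odot> B) i j = (\<Sum>k\<le>i. A i k * B k j)"
  by (rule imat_mult_eq_sum) (use assms in \<open>auto simp: lower_unitriangular_def\<close>)

lemma lower_unitriangular_vec_eq_sum:
  assumes "lower_unitriangular A"
  shows "(A \<odot>\<^sub>v v) i = (\<Sum>k\<le>i. A i k * v k)"
  by (simp add: imat_vec_eq_mult[where j = 0] lower_unitriangular_mult_eq_sum[OF assms])

section \<open>Inverses of lower unitriangular matrices\<close>

text \<open>
  Forward substitution, one column at a time.
\<close>
fun right_inv :: "imat \<Rightarrow> imat" where
  "right_inv A i j =
     (if i < j then 0 else if i = j then 1 else - (\<Sum>k\<in>{j..<i}. A i k * right_inv A k j))"

declare right_inv.simps [simp del]

lemma lower_unitriangular_right_inv: "lower_unitriangular (right_inv A)"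
  by (auto simp: lower_unitriangular_def right_inv.simps)

lemma mult_right_inv:
  assumes "lower_unitriangular A"
  shows "A \<odot> right_inv A = diag (\<lambda>_. 1)"
proof (intro ext)
  fix i j
  have upper: "right_inv A k j = 0" if "k < j" for k
    using that by (simp add: right_inv.simps)
  have one: "right_inv A j j = 1" "A i i = 1"
    using assms by (simp_all add: right_inv.simps lower_unitriangular_def)
  show "(A \<odot> right_inv A) i j = diag (\<lambda>_. 1) i j"
  proof (cases "i \<le> j")
    case True
    have "(A \<odot> right_inv A) i j = (\<Sum>k\<in>{i}. A i k * right_inv A k j)"
      by (rule imat_mult_eq_sum)
         (use assms True upper in \<open>auto simp: lower_unitriangular_def neq_iff\<close>)
    then show ?thesis
      using True one upper[of i] by (auto simp: diag_def)
  next
    case False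
    have "(A \<odot> right_inv A) i j = (\<Sum>k\<in>insert i {j..<i}. A i k * right_inv A k j)"
      by (rule imat_mult_eq_sum)
         (use assms upper in \<open>auto simp: lower_unitriangular_def neq_iff not_le\<close>)
    also have "\<dots> = right_inv A i j + (\<Sum>k\<in>{j..<i}. A i k * right_inv A k j)"
      using one by simp
    also have "\<dots> = 0"
      using False by (subst (1) right_inv.simps) simp
    finally show ?thesis
      using False by (simp add: diag_def)
  qed
qed

text \<open>
  The right inverse $B$ of $A$ is again lower unitriangular, hence has a right inverse $C$ itself.
  Then $A = A (B C) = (A B) C = C$, so $B$ is a two-sided inverse; uniqueness is the usual
  computation $B' = B' (A B) = B$.
\<close>
lemma lower_inv_properties:
  assumes A: "lower_unitriangular A"
  shows lower_unitriangular_lower_inv: "lower_unitriangular (lower_inv A)"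
    and mult_lower_inv: "A \<odot> lower_inv A = diag (\<lambda>_. 1)"
    and lower_inv_mult: "lower_inv A \<odot> A = diag (\<lambda>_. 1)"
proof -
  let ?B = "right_inv A" and ?C = "right_inv (right_inv A)"
  have B: "lower_unitriangular ?B" and AB: "A \<odot> ?B = diag (\<lambda>_. 1)"
    and BC: "?B \<odot> ?C = diag (\<lambda>_. 1)"
    using A by (simp_all add: lower_unitriangular_right_inv mult_right_inv)
  have fin: "row_finite A" "row_finite ?B"
    using A B by (simp_all add: row_finite_lower_unitriangular)
  have "A = A \<odot> (?B \<odot> ?C)"
    by (simp add: BC)
  also have "\<dots> = ?C"
    by (simp add: imat_mult_assoc[OF fin, symmetric] AB)
  finally have BA: "?B \<odot> A = diag (\<lambda>_. 1)"
    using BC by simp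
  have "\<exists>!B. lower_unitriangular B \<and> A \<odot> B = diag (\<lambda>_. 1) \<and> B \<odot> A = diag (\<lambda>_. 1)"
  proof (rule ex1I[of _ ?B])
    show "lower_unitriangular ?B \<and> A \<odot> ?B = diag (\<lambda>_. 1) \<and> ?B \<odot> A = diag (\<lambda>_. 1)"
      using B AB BA by simp
  next
    fix B' assume B': "lower_unitriangular B' \<and> A \<odot> B' = diag (\<lambda>_. 1) \<and> B' \<odot> A = diag (\<lambda>_. 1)"
    have "B' = B' \<odot> (A \<odot> ?B)"
      by (simp add: AB)
    also have "\<dots> = ?B"
      using B' fin by (simp add: imat_mult_assoc[symmetric] row_finite_lower_unitriangular)
    finally show "B' = ?B" .
  qed
  from theI'[OF this, folded lower_inv_def]
  show "lower_unitriangular (lower_inv A)" "A \<odot> lower_inv A = diag (\<lambda>_. 1)"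
    "lower_inv A \<odot> A = diag (\<lambda>_. 1)" by auto
qed

section \<open>The Gauss--Borel factorization\<close>

text \<open>
  A double sum that is visibly symmetric when $G$ is.
\<close>
lemma lower_congruence_entry:
  assumes "lower_unitriangular S"
  shows "((S \<odot> G) \<odot> imat_transpose S) i j = (\<Sum>k\<le>i. \<Sum>m\<le>j. S i k * G k m * S j m)"
proof -
  have "((S \<odot> G) \<odot> imat_transpose S) i j = (\<Sum>m\<le>j. (S \<odot> G) i m * S j m)"
    using imat_mult_eq_sum[of "{..j}" "S \<odot> G" i "imat_transpose S" j] assms
    by (auto simp: imat_transpose_def lower_unitriangular_def)
  also have "\<dots> = (\<Sum>m\<le>j. \<Sum>k\<le>i. S i k * G k m * S j m)"
    by (simp add: lower_unitriangular_mult_eq_sum[OF assms] sum_distrib_right)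
  finally show ?thesis
    by (subst (asm) sum.swap)
qed

lemma lower_congruence_symmetric:
  assumes S: "lower_unitriangular S" and G: "\<And>i j. G i j = G j i"
  shows "((S \<odot> G) \<odot> imat_transpose S) i j = ((S \<odot> G) \<odot> imat_transpose S) j i"
proof -
  have "(\<Sum>k\<le>i. \<Sum>m\<le>j. S i k * G k m * S j m) = (\<Sum>m\<le>j. \<Sum>k\<le>i. S j m * G m k * S i k)"
    by (subst sum.swap) (use G in \<open>simp add: mult_ac\<close>)
  then show ?thesis
    by (simp add: lower_congruence_entry[OF S])
qed

lemma upper_mult_transpose_lower:
  assumes S: "lower_unitriangular S" and B: "\<And>i j. j < i \<Longrightarrow> B i j = 0" and "j \<le> i"
  shows "(B \<odot> imat_transpose S) i j = (if i = j then B i i else 0)"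
proof -
  have "(B \<odot> imat_transpose S) i j = (\<Sum>k\<in>{i}. B i k * imat_transpose S k j)"
    by (rule imat_mult_eq_sum)
       (use assms in \<open>auto simp: imat_transpose_def lower_unitriangular_def neq_iff\<close>)
  then show ?thesis
    using assms by (auto simp: imat_transpose_def lower_unitriangular_def)
qed

text \<open>
  The factorization says that $S G = H S^{-\top}$ is upper triangular with diagonal $H$. This form
  is linear in the rows of $S$, so existence and uniqueness reduce to finite linear systems. For
  the direction from right to left, $S G S^\top$ is the product of two upper triangular
  matrices and it is symmetric; hence it is diagonal.
\<close>
lemma gauss_borel_iff_upper:
  assumes S: "lower_unitriangular S" and G: "\<And>i j. G i j = G j i"
  shows "gauss_borel G S h \<longleftrightarrow> (\<forall>i j. j \<le> i \<longrightarrow> (S \<odot> G) i j = (if i = j then h i else 0))"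
    (is "?lhs \<longleftrightarrow> ?rhs")
proof -
  let ?L = "lower_inv S" and ?D = "diag h" and ?T = "imat_transpose"
  note L = lower_inv_properties[OF S]
  have fin: "row_finite S" "row_finite ?L" "row_finite (?L \<odot> ?D)" "row_finite (S \<odot> ?L)"
    using S L(1) by (simp_all add: row_finite_imat_mult row_finite_lower_unitriangular)
  show ?thesis
  proof
    assume ?lhs
    then have "G = (?L \<odot> ?D) \<odot> ?T ?L"
      by (simp add: gauss_borel_def)
    then have "S \<odot> G = ((S \<odot> ?L) \<odot> ?D) \<odot> ?T ?L"
      using fin by (simp add: imat_mult_assoc)
    then have "S \<odot> G = ?D \<odot> ?T ?L"
      using L by simp
    then show ?rhs
      using L(1) by (auto simp: diag_mult imat_transpose_def lower_unitriangular_def)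
  next
    assume R: ?rhs
    have K: "((S \<odot> G) \<odot> ?T S) i j = ?D i j" if "j \<le> i" for i j
      using upper_mult_transpose_lower[OF S _ that, of "S \<odot> G"] R by (auto simp: diag_def)
    have "(S \<odot> G) \<odot> ?T S = ?D"
    proof (intro ext)
      fix i j show "((S \<odot> G) \<odot> ?T S) i j = ?D i j"
      proof (cases "j \<le> i")
        case False
        then show ?thesis
          using K[of i j] lower_congruence_symmetric[where G = G, OF S G, of i j] by (auto simp: diag_def)
      qed (rule K)
    qed
    then have "?T ((S \<odot> G) \<odot> ?T S) = ?D"
      by simp
    then have "S \<odot> ?T (S \<odot> G) = ?D"
      by (simp add: transpose_mult[of "S \<odot> G"])
    then have "?L \<odot> (S \<odot> ?T (S \<odot> G)) = ?L \<odot> ?D"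
      by simp
    then have "?T (S \<odot> G) = ?L \<odot> ?D"
      using fin L by (simp add: imat_mult_assoc[symmetric])
    then have "S \<odot> G = ?T (?L \<odot> ?D)"
      by (metis transpose_transpose)
    then have "S \<odot> G = ?D \<odot> ?T ?L"
      by (simp add: transpose_mult)
    then have "?L \<odot> (S \<odot> G) = (?L \<odot> ?D) \<odot> ?T ?L"
      using fin by (simp add: imat_mult_assoc)
    then have "G = (?L \<odot> ?D) \<odot> ?T ?L"
      using fin L by (simp add: imat_mult_assoc[symmetric])
    then show ?lhs
      using S by (simp add: gauss_borel_def)
  qed
qed

text \<open>
  This lemma and the next, on leading principal submatrices, are phrased with left multiplication, as needed
  for the rows of $S$; the symmetry of $G$ turns this into multiplication by a column.
\<close>
lemma det_nonzero_kernel: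
  fixes G :: imat
  assumes det: "Determinant.det (Matrix.mat n n (\<lambda>(i, j). G i j)) \<noteq> 0" and G: "\<And>i j. G i j = G j i"
    and ker: "\<And>j. j < n \<Longrightarrow> (\<Sum>i<n. s i * G i j) = 0" and i: "i < n"
  shows "s i = 0"
proof -
  let ?M = "Matrix.mat n n (\<lambda>(i, j). G i j)"
  let ?v = "Matrix.vec n s"
  have "?M *\<^sub>v ?v = 0\<^sub>v n"
  proof (rule eq_vecI)
    fix j assume "j < dim_vec (0\<^sub>v n :: complex Matrix.vec)"
    then show "vec_index (?M *\<^sub>v ?v) j = vec_index (0\<^sub>v n) j"
      using ker[of j] G by (simp add: scalar_prod_def atLeast0LessThan mult.commute)
  qed simp
  then have "?v = 0\<^sub>v n"
    using det_0_iff_vec_prod_zero_field[of ?M n] det by (metis mat_carrier vec_carrier)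
  then show ?thesis
    using i by (metis index_vec index_zero_vec(1))
qed

lemma det_nonzero_solve:
  fixes G :: imat
  assumes det: "Determinant.det (Matrix.mat n n (\<lambda>(i, j). G i j)) \<noteq> 0" and G: "\<And>i j. G i j = G j i"
  shows "\<exists>s. \<forall>j<n. (\<Sum>i<n. s i * G i j) = b j"
proof -
  let ?M = "Matrix.mat n n (\<lambda>(i, j). G i j)"
  obtain B where B: "B \<in> carrier_mat n n" "?M * B = 1\<^sub>m n"
    using det_non_zero_imp_unit[of ?M n "()"] det
    by (auto simp: Units_def ring_mat_def)
  define s where "s = B *\<^sub>v Matrix.vec n b"
  have s: "s \<in> carrier_vec n"
    using B by (simp add: s_def)
  have Ms: "?M *\<^sub>v s = Matrix.vec n b"
    using B by (simp add: s_def flip: assoc_mult_mat_vec[of ?M n n B n])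
  have "(\<Sum>i<n. vec_index s i * G i j) = b j" if "j < n" for j
  proof -
    have "(\<Sum>i<n. vec_index s i * G i j) = vec_index (?M *\<^sub>v s) j"
      using that s G by (simp add: scalar_prod_def atLeast0LessThan mult.commute)
    then show ?thesis
      using that by (simp add: Ms)
  qed
  then show ?thesis
    by (intro exI[of _ "vec_index s"]) blast
qed

lemma lower_unitriangular_mult_split:
  assumes "lower_unitriangular S"
  shows "(S \<odot> G) i j = (\<Sum>k<i. S i k * G k j) + G i j"
  using assms lower_unitriangular_mult_eq_sum[OF assms, of G i j]
  by (simp add: lower_unitriangular_def lessThan_Suc_atMost[symmetric])

text \<open>
  The entries of row $n$ left of the diagonal solve a linear system with the leading
  $n \times n$ block of $G$; it expresses that row $n$ of $S G$ vanishes left of the diagonal.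
\<close>
lemma gauss_borel_exists:
  assumes det: "\<And>n. n \<ge> 1 \<Longrightarrow> Determinant.det (Matrix.mat n n (\<lambda>(i, j). G i j)) \<noteq> 0"
    and G: "\<And>i j. G i j = G j i"
  shows "\<exists>S h. gauss_borel G S h"
proof -
  have "\<exists>s. \<forall>j<n. (\<Sum>i<n. s i * G i j) = - G n j" for n
    using det_nonzero_solve[of n G "\<lambda>j. - G n j"] det[of n] G by (cases "n = 0") auto
  then obtain s where s: "\<And>n j. j < n \<Longrightarrow> (\<Sum>i<n. s n i * G i j) = - G n j"
    by metis
  define S :: imat where "S = (\<lambda>i j. if j < i then s i j else if i = j then 1 else 0)"
  have S: "lower_unitriangular S"
    by (auto simp: S_def lower_unitriangular_def)
  have Ss: "S i k = s i k" if "k < i" for i k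
    using that by (simp add: S_def)
  have "(S \<odot> G) i j = 0" if "j < i" for i j
    using s[OF that] by (simp add: lower_unitriangular_mult_split[OF S] Ss)
  then have "gauss_borel G S (\<lambda>i. (S \<odot> G) i i)"
    by (auto simp: gauss_borel_iff_upper[where G = G, OF S G])
  then show ?thesis by blast
qed

text \<open>
  The difference of two candidates for row $n$ is supported on the first $n$ positions and
  annihilated by the leading $n \times n$ block.
\<close>
lemma gauss_borel_unique:
  assumes det: "\<And>n. n \<ge> 1 \<Longrightarrow> Determinant.det (Matrix.mat n n (\<lambda>(i, j). G i j)) \<noteq> 0"
    and G: "\<And>i j. G i j = G j i"
    and 1: "gauss_borel G S h" and 2: "gauss_borel G S' h'"
  shows "S = S' \<and> h = h'"
proof -
  have S: "lower_unitriangular S" "lower_unitriangular S'"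
    using 1 2 by (simp_all add: gauss_borel_def)
  note up = 1[unfolded gauss_borel_iff_upper[where G = G, OF S(1) G], rule_format]
    2[unfolded gauss_borel_iff_upper[where G = G, OF S(2) G], rule_format]
  have "S i k = S' i k" if "k < i" for i k
  proof -
    have "(\<Sum>k<i. (S i k - S' i k) * G k j) = 0" if "j < i" for j
      using up[of j i] that
      by (simp add: lower_unitriangular_mult_split[OF S(1)] lower_unitriangular_mult_split[OF S(2)]
          left_diff_distrib sum_subtractf) (metis add_right_cancel)
    from det_nonzero_kernel[where G = G and s = "\<lambda>k. S i k - S' i k" and n = i, OF _ G this that]
    have "S i k - S' i k = 0"
      using det[of i] that by simp
    then show ?thesis by simp
  qed
  moreover have "S i k = S' i k" if "\<not> k < i" for i k
    using S that by (cases "i = k") (auto simp: lower_unitriangular_def)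
  ultimately have "S = S'"
    by (intro ext) blast
  moreover have "h i = h' i" for i
    using up[of i i] \<open>S = S'\<close> by simp
  ultimately show ?thesis by auto
qed

text \<open>
  If $h_n = 0$, then row $n$ of $S$ is a kernel vector of the leading block of size $n + 1$,
  although its last entry is $1$.
\<close>
lemma gauss_borel_diagonal_nonzero:
  assumes det: "\<And>n. n \<ge> 1 \<Longrightarrow> Determinant.det (Matrix.mat n n (\<lambda>(i, j). G i j)) \<noteq> 0"
    and G: "\<And>i j. G i j = G j i" and gb: "gauss_borel G S h"
  shows "h n \<noteq> 0"
proof
  assume 0: "h n = 0"
  have S: "lower_unitriangular S"
    using gb by (simp add: gauss_borel_def)
  note up = gb[unfolded gauss_borel_iff_upper[where G = G, OF S G], rule_format]
  have "(\<Sum>k<Suc n. S n k * G k j) = 0" if "j < Suc n" for j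
    using up[of j n] that 0 unfolding lower_unitriangular_mult_eq_sum[OF S]
    by (simp add: lessThan_Suc_atMost split: if_splits)
  from det_nonzero_kernel[where G = G and s = "S n" and n = "Suc n", OF _ G this lessI]
  have "S n n = 0"
    using det[of "Suc n"] by simp
  then show False
    using S by (simp add: lower_unitriangular_def)
qed

section \<open>The Jacobi matrix\<close>

text \<open>
  Above the diagonal the entries come from triangularity, on the diagonal from $J S = S \Lambda$,
  and below it from the symmetry of $J H = S \Lambda G S^\top$, which transports the superdiagonal.
\<close>
lemma jacobi_matrix_entries:
  assumes gb: "gauss_borel G S h" and h: "\<And>n. h n \<noteq> 0"
    and hankel: "\<And>i j. G i j = m (i + j)"
  defines "J \<equiv> S \<odot> shift \<odot> lower_inv S"
  shows "J k (k + 1) = 1" "J (k + 1) k = h (k + 1) / h k"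
    "k \<ge> 1 \<Longrightarrow> J k k = S k (k - 1) - S (k + 1) k"
    "j > k + 1 \<Longrightarrow> J k j = 0" "j + 1 < k \<Longrightarrow> J k j = 0"
proof -
  let ?L = "lower_inv S" and ?D = "diag h" and ?T = "imat_transpose"
  have S: "lower_unitriangular S"
    using gb by (simp add: gauss_borel_def)
  note L = lower_inv_properties[OF S]
  have fin: "row_finite S" "row_finite ?L" "row_finite (S \<odot> shift)" "row_finite (?L \<odot> ?D)" "row_finite J"
    using S L(1) by (simp_all add: J_def row_finite_imat_mult row_finite_lower_unitriangular)
  have upper: "J k j = (if j = k + 1 then 1 else 0)" if "j \<ge> k + 1" for k j
  proof -
    have "J k j = (\<Sum>i\<in>{k + 1}. (S \<odot> shift) k i * ?L i j)"
      unfolding J_def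
      by (rule imat_mult_eq_sum)
         (use that S L(1) in \<open>auto simp: mult_shift lower_unitriangular_def neq_iff\<close>)
    then show ?thesis
      using that S L(1) by (auto simp: mult_shift lower_unitriangular_def)
  qed
  then show "J k (k + 1) = 1" "j > k + 1 \<Longrightarrow> J k j = 0" by auto
  have JS: "J \<odot> S = S \<odot> shift"
    by (simp add: J_def imat_mult_assoc[OF fin(3,2)] L(3))
  show "J k k = S k (k - 1) - S (k + 1) k" if "k \<ge> 1"
  proof -
    have "(J \<odot> S) k k = (\<Sum>i\<in>{k, k + 1}. J k i * S i k)"
      by (rule imat_mult_eq_sum)
         (use S upper in \<open>auto simp: lower_unitriangular_def neq_iff not_less_eq Suc_le_eq\<close>)
    then show ?thesis
      using that S upper[of k "k + 1"] by (auto simp: JS mult_shift lower_unitriangular_def)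
  qed
  have "G = (?L \<odot> ?D) \<odot> ?T ?L"
    using gb by (simp add: gauss_borel_def)
  then have "G \<odot> ?T S = ((?L \<odot> ?D) \<odot> ?T ?L) \<odot> ?T S"
    by (rule arg_cong)
  also have "\<dots> = (?L \<odot> ?D) \<odot> (?T ?L \<odot> ?T S)"
    by (rule imat_mult_assoc_column_finite) (use fin in simp_all)
  also have "\<dots> = ?L \<odot> ?D"
    using L by (simp flip: transpose_mult)
  finally have GS: "G \<odot> ?T S = ?L \<odot> ?D" .
  have "J \<odot> ?D = (S \<odot> shift) \<odot> (?L \<odot> ?D)"
    unfolding J_def by (rule imat_mult_assoc) (use fin in simp_all)
  also have "\<dots> = ((S \<odot> shift) \<odot> G) \<odot> ?T S"
    using fin by (simp add: GS[symmetric] imat_mult_assoc_column_finite)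
  also have "\<dots> = (S \<odot> (shift \<odot> G)) \<odot> ?T S"
    using fin by (simp add: imat_mult_assoc)
  \<comment> \<open>The Hankel property makes $\Lambda G$, with entries $m_{i+j+1}$, symmetric.\<close>
  finally have "J i j * h j = J j i * h i" for i j
    using lower_congruence_symmetric[OF S, of "shift \<odot> G" i j] hankel
    by (simp add: mult_diag[symmetric] shift_mult add.commute)
  note sym = this
  show "J (k + 1) k = h (k + 1) / h k"
    using sym[of "k + 1" k] upper[of k "k + 1"] h[of k] by (simp add: field_simps)
  show "J k j = 0" if "j + 1 < k"
    using sym[of k j] upper[of j k] h[of j] that by simp
qed

lemma jacobi_matrix_vec:
  assumes gb: "gauss_borel G S h" and h: "\<And>n. h n \<noteq> 0"
    and hankel: "\<And>i j. G i j = m (i + j)" and k: "k \<ge> 1"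
  shows "((S \<odot> shift \<odot> lower_inv S) \<odot>\<^sub>v v) k =
    h k / h (k - 1) * v (k - 1) + (S k (k - 1) - S (k + 1) k) * v k + v (k + 1)"
proof -
  let ?J = "S \<odot> shift \<odot> lower_inv S"
  note J = jacobi_matrix_entries[where G = G and m = m, OF gb h hankel]
  obtain l where l: "k = l + 1"
    using k by (metis add.commute le_Suc_ex)
  have "(?J \<odot>\<^sub>v v) k = (\<Sum>j\<in>{l, l + 1, l + 2}. ?J k j * v j)"
    unfolding imat_vec_def
  proof (rule suminf_finite)
    fix j assume "j \<notin> {l, l + 1, l + 2}"
    then have "j + 1 < k \<or> j > k + 1"
      using l by auto
    then show "?J k j * v j = 0"
      using J(4,5) by auto
  qed simp
  then show ?thesis
    using J(1)[of k] J(2)[of l] J(3)[OF k] l by simp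
qed

text \<open>
  The intertwining property $J S = S \Lambda$, applied to a vector. It yields both
  eigenvalue relations: once for the monomials and once for the functions $R_j(z)$.
\<close>
lemma jacobi_matrix_mult:
  assumes S: "lower_unitriangular S"
  shows "(S \<odot> shift \<odot> lower_inv S) \<odot>\<^sub>v (S \<odot>\<^sub>v v) = S \<odot>\<^sub>v (shift \<odot>\<^sub>v v)"
proof -
  note L = lower_inv_properties[OF S]
  have fin: "row_finite S" "row_finite (lower_inv S)" "row_finite (S \<odot> shift)"
    using S L(1) by (simp_all add: row_finite_imat_mult row_finite_lower_unitriangular)
  have "lower_inv S \<odot>\<^sub>v (S \<odot>\<^sub>v v) = v"
    using L fin by (simp flip: imat_vec_assoc)
  then show ?thesis
    using fin by (simp add: imat_vec_assoc)
qed

lemma gauss_borel_factors: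
  assumes "quasi_definite u"
  shows "gauss_borel (moment_matrix u) (S_mat u) (H_diag u)" and "H_diag u n \<noteq> 0"
proof -
  let ?G = "moment_matrix u"
  have det: "\<And>n. n \<ge> 1 \<Longrightarrow> Determinant.det (Matrix.mat n n (\<lambda>(i, j). ?G i j)) \<noteq> 0"
    using assms by (simp add: quasi_definite_def)
  have G: "?G i j = ?G j i" for i j
    by (simp add: moment_matrix_def add.commute)
  obtain S h where Sh: "gauss_borel ?G S h"
    using gauss_borel_exists[OF det G] by blast
  have "gauss_borel_factors u = (S, h)"
    unfolding gauss_borel_factors_def
    by (rule the_equality) (use Sh gauss_borel_unique[OF det G] in auto)
  then show *: "gauss_borel ?G (S_mat u) (H_diag u)"
    using Sh by (simp add: S_mat_def H_diag_def)
  show "H_diag u n \<noteq> 0"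
    by (rule gauss_borel_diagonal_nonzero[OF det G *])
qed

section \<open>The Cauchy kernel and complex measures\<close>

text \<open>
  A lower bound for $|z - x|$ almost everywhere dominates the kernel by a multiple of
  $|x|^j$. The pointwise identity behind the recurrence may fail on a null set: for real $z$
  the point $x = z$ is exceptional, since division by zero yields zero there.
\<close>
lemma cauchy_kernel_integrals:
  fixes \<nu> :: "real measure" and z :: complex
  assumes sets: "sets \<nu> = sets borel"
    and mom: "\<And>n. integrable \<nu> (\<lambda>x. complex_of_real (\<bar>x\<bar> ^ n))"
    and e: "e > 0" and sep: "AE x in \<nu>. e \<le> cmod (z - complex_of_real x)"
  shows integral_cauchy_sum:
      "integral\<^sup>L \<nu> (\<lambda>x. (\<Sum>j\<le>n. c j * complex_of_real x ^ j) / (z - complex_of_real x)) =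
       (\<Sum>j\<le>n. c j * integral\<^sup>L \<nu> (\<lambda>x. complex_of_real x ^ j / (z - complex_of_real x)))"
    and integral_cauchy_Suc:
      "integral\<^sup>L \<nu> (\<lambda>x. complex_of_real x ^ (j + 1) / (z - complex_of_real x)) =
       z * integral\<^sup>L \<nu> (\<lambda>x. complex_of_real x ^ j / (z - complex_of_real x)) -
       integral\<^sup>L \<nu> (\<lambda>x. complex_of_real x ^ j)"
proof -
  have meas: "f \<in> borel_measurable \<nu>" if "f \<in> borel_measurable borel" for f :: "real \<Rightarrow> complex"
    using that measurable_cong_sets[OF sets refl] by blast
  have P: "integrable \<nu> (\<lambda>x. complex_of_real x ^ j)" for j
    by (rule Bochner_Integration.integrable_bound[OF mom[of j]])
       (auto intro!: meas simp: norm_power)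
  have I: "integrable \<nu> (\<lambda>x. complex_of_real x ^ j / (z - complex_of_real x))" for j
  proof (rule Bochner_Integration.integrable_bound)
    show "integrable \<nu> (\<lambda>x. complex_of_real (1 / e) * complex_of_real (\<bar>x\<bar> ^ j))"
      using mom by (intro integrable_mult_right) auto
    show "AE x in \<nu>. cmod (complex_of_real x ^ j / (z - complex_of_real x))
        \<le> cmod (complex_of_real (1 / e) * complex_of_real (\<bar>x\<bar> ^ j))"
      using sep
    proof eventually_elim
      case (elim x)
      then have "\<bar>x\<bar> ^ j / cmod (z - complex_of_real x) \<le> \<bar>x\<bar> ^ j / e"
        using e by (intro divide_left_mono mult_pos_pos) auto
      then show ?case
        using e by (simp add: norm_divide norm_mult norm_power)
    qed
  qed (auto intro!: meas)
  show "integral\<^sup>L \<nu> (\<lambda>x. (\<Sum>j\<le>n. c j * complex_of_real x ^ j) / (z - complex_of_real x)) =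
       (\<Sum>j\<le>n. c j * integral\<^sup>L \<nu> (\<lambda>x. complex_of_real x ^ j / (z - complex_of_real x)))"
  proof -
    have "(\<lambda>x. (\<Sum>j\<le>n. c j * complex_of_real x ^ j) / (z - complex_of_real x)) =
        (\<lambda>x. \<Sum>j\<le>n. c j * (complex_of_real x ^ j / (z - complex_of_real x)))"
      by (simp add: sum_divide_distrib)
    then show ?thesis
      by (simp only:, subst Bochner_Integration.integral_sum)
         (auto intro!: integrable_mult_right I simp del: times_divide_eq_right)
  qed
  have "AE x in \<nu>. complex_of_real x ^ (j + 1) / (z - complex_of_real x) =
      z * (complex_of_real x ^ j / (z - complex_of_real x)) - complex_of_real x ^ j"
    using sep
  proof eventually_elim
    case (elim x)
    then have "z - complex_of_real x \<noteq> 0"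
      using e by auto
    then show ?case
      by (simp add: field_simps)
  qed
  then have "integral\<^sup>L \<nu> (\<lambda>x. complex_of_real x ^ (j + 1) / (z - complex_of_real x)) =
      integral\<^sup>L \<nu> (\<lambda>x. z * (complex_of_real x ^ j / (z - complex_of_real x)) - complex_of_real x ^ j)"
    by (intro integral_cong_AE) (auto intro!: meas)
  also have "\<dots> = z * integral\<^sup>L \<nu> (\<lambda>x. complex_of_real x ^ j / (z - complex_of_real x)) -
       integral\<^sup>L \<nu> (\<lambda>x. complex_of_real x ^ j)"
    using I P by (subst Bochner_Integration.integral_diff)
      (auto intro!: integrable_mult_right simp del: times_divide_eq_right)
  finally show "integral\<^sup>L \<nu> (\<lambda>x. complex_of_real x ^ (j + 1) / (z - complex_of_real x)) =
       z * integral\<^sup>L \<nu> (\<lambda>x. complex_of_real x ^ j / (z - complex_of_real x)) -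
       integral\<^sup>L \<nu> (\<lambda>x. complex_of_real x ^ j)" .
qed

lemma sets_upper_variation: "sets (upper_variation \<nu>) = sets borel"
  using sets.sets_measure_of_eq[of "borel :: real measure"]
  by (simp add: upper_variation_def)

text \<open>
  The supremum defining the upper variation of $A$ is zero. This settles the matter even without
  countable additivity of the set function, since \<open>measure_of\<close> is the zero measure in its absence.
\<close>
lemma upper_variation_null:
  assumes "A \<in> sets borel" and "\<And>B. B \<in> sets borel \<Longrightarrow> B \<subseteq> A \<Longrightarrow> \<nu> B = 0"
  shows "A \<in> null_sets (upper_variation \<nu>)"
proof -
  have "(SUP B\<in>{B \<in> sets borel. B \<subseteq> A}. ennreal (\<nu> B)) = 0"
    using assms by (auto simp: SUP_eq_iff intro!: SUP_eq_const)
  then have "emeasure (upper_variation \<nu>) A = 0"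
    by (simp add: upper_variation_def emeasure_measure_of_conv)
  then show ?thesis
    using assms(1) by (simp add: null_sets_def sets_upper_variation)
qed

text \<open>
  For nonreal $z$ the distance to the real line serves as $e$. For real $z$ the complex measure vanishes
  on all Borel subsets of an interval around $z$, and so do the four measures, which arise from
  $\phi \in \{\mathrm{Re}, -\mathrm{Re}, \mathrm{Im}, -\mathrm{Im}\}$; one $e$ serves all of them.
\<close>
lemma upper_variation_separation:
  assumes "z \<notin> complex_of_real ` measure_support \<mu>"
  shows "\<exists>e>0. \<forall>\<phi>. \<phi> 0 = 0 \<longrightarrow>
    (AE x in upper_variation (\<lambda>A. \<phi> (\<mu> A)). e \<le> cmod (z - complex_of_real x))"
proof (cases "Im z = 0")
  case False
  have "\<bar>Im z\<bar> \<le> cmod (z - complex_of_real x)" for x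
    using abs_Im_le_cmod[of "z - complex_of_real x"] by simp
  then show ?thesis
    using False by (intro exI[of _ "\<bar>Im z\<bar>"]) auto
next
  case True
  define t where "t = Re z"
  have z: "z = complex_of_real t"
    using True by (simp add: t_def complex_eq_iff)
  then have "t \<notin> measure_support \<mu>"
    using assms by auto
  then obtain U where U: "open U" "t \<in> U" "\<And>A. A \<in> sets borel \<Longrightarrow> A \<subseteq> U \<Longrightarrow> \<mu> A = 0"
    by (auto simp: measure_support_def)
  then obtain e where e: "e > 0" "ball t e \<subseteq> U"
    by (meson openE)
  have "AE x in upper_variation (\<lambda>A. \<phi> (\<mu> A)). e \<le> cmod (z - complex_of_real x)" if "\<phi> 0 = 0" for \<phi>
  proof (rule AE_I')
    show "ball t e \<in> null_sets (upper_variation (\<lambda>A. \<phi> (\<mu> A)))"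
      by (rule upper_variation_null) (use U e that in auto)
    show "{x \<in> space (upper_variation (\<lambda>A. \<phi> (\<mu> A))). \<not> e \<le> cmod (z - complex_of_real x)} \<subseteq> ball t e"
      by (auto simp: z dist_real_def simp flip: of_real_diff)
  qed
  then show ?thesis
    using e(1) by blast
qed

lemma measure_action:
  assumes adm: "admissible (Measure \<mu>)" and z: "z \<notin> complex_of_real ` supp (Measure \<mu>)"
  defines "A \<equiv> action (Measure \<mu>)"
  shows measure_action_sum: "A (\<lambda>x. (\<Sum>j\<le>n. c j * complex_of_real x ^ j) / (z - complex_of_real x)) =
       (\<Sum>j\<le>n. c j * A (\<lambda>x. complex_of_real x ^ j / (z - complex_of_real x)))"
    and measure_action_Suc: "A (\<lambda>x. complex_of_real x ^ (j + 1) / (z - complex_of_real x)) =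
       z * A (\<lambda>x. complex_of_real x ^ j / (z - complex_of_real x)) - A (\<lambda>x. complex_of_real x ^ j)"
proof -
  have "z \<notin> complex_of_real ` measure_support \<mu>"
    using z by simp
  from upper_variation_separation[OF this] obtain e where e: "e > 0"
    and sep: "\<And>\<phi>. \<phi> 0 = 0 \<Longrightarrow>
      (AE x in upper_variation (\<lambda>A. \<phi> (\<mu> A)). e \<le> cmod (z - complex_of_real x))"
    by blast
  have mom: "cm_integrable \<mu> (\<lambda>x. complex_of_real (\<bar>x\<bar> ^ n))" for n
    using adm by (simp add: finite_absolute_moments_def)
  \<comment> \<open>the same two identities for each of the four measures that make up the integral\<close>
  note ints = cauchy_kernel_integrals[OF sets_upper_variation mom[unfolded cm_integrable_def, THEN conjunct1] e sep[of Re]]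
    cauchy_kernel_integrals[OF sets_upper_variation mom[unfolded cm_integrable_def, THEN conjunct2, THEN conjunct1] e sep[of "\<lambda>x. - Re x"]]
    cauchy_kernel_integrals[OF sets_upper_variation mom[unfolded cm_integrable_def, THEN conjunct2, THEN conjunct2, THEN conjunct1] e sep[of Im]]
    cauchy_kernel_integrals[OF sets_upper_variation mom[unfolded cm_integrable_def, THEN conjunct2, THEN conjunct2, THEN conjunct2] e sep[of "\<lambda>x. - Im x"]]
  show "A (\<lambda>x. (\<Sum>j\<le>n. c j * complex_of_real x ^ j) / (z - complex_of_real x)) =
       (\<Sum>j\<le>n. c j * A (\<lambda>x. complex_of_real x ^ j / (z - complex_of_real x)))"
    unfolding A_def action.simps cm_integral_def
    by (simp add: ints sum_subtractf sum_distrib_left sum.distrib algebra_simps)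
  show "A (\<lambda>x. complex_of_real x ^ (j + 1) / (z - complex_of_real x)) =
       z * A (\<lambda>x. complex_of_real x ^ j / (z - complex_of_real x)) - A (\<lambda>x. complex_of_real x ^ j)"
    unfolding A_def action.simps cm_integral_def
    by (simp add: ints[simplified] algebra_simps)
qed

section \<open>Smooth functions and the Leibniz rule\<close>

text \<open>
  Smoothness is proved below by exhibiting all derivatives at once, because closed formulas for
  the whole sequence are available (Leibniz rule, powers of the Cauchy kernel, \<open>flat\<close>).
\<close>
definition deriv_seq :: "(nat \<Rightarrow> real \<Rightarrow> complex) \<Rightarrow> bool" where
  "deriv_seq F \<longleftrightarrow> (\<forall>j x. (F j has_vector_derivative F (Suc j) x) (at x))"

lemma nth_deriv_0 [simp]: "nth_deriv 0 f = f"
  by (simp add: nth_deriv_def)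

lemma nth_deriv_Suc: "nth_deriv (Suc j) f = (\<lambda>x. vector_derivative (nth_deriv j f) (at x))"
  by (simp add: nth_deriv_def)

lemma smooth_iff_deriv_seq: "smooth f \<longleftrightarrow> deriv_seq (\<lambda>j. nth_deriv j f)"
  by (simp add: smooth_def deriv_seq_def nth_deriv_Suc vector_derivative_works)

lemma nth_deriv_eq:
  assumes "deriv_seq F"
  shows "nth_deriv j (F 0) = F j"
proof (induction j)
  case (Suc j)
  then show ?case
    using assms by (auto simp: nth_deriv_Suc deriv_seq_def intro!: ext vector_derivative_at)
qed simp

lemma deriv_seq_smooth: "deriv_seq F \<Longrightarrow> smooth (F 0)"
  by (simp add: smooth_iff_deriv_seq nth_deriv_eq)

lemma smooth_has_vector_derivative:
  "smooth f \<Longrightarrow> (nth_deriv j f has_vector_derivative nth_deriv (Suc j) f x) (at x)"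
  by (simp add: smooth_iff_deriv_seq deriv_seq_def)

lemma smooth_continuous_on: "smooth f \<Longrightarrow> continuous_on S (nth_deriv j f)"
  using smooth_has_vector_derivative[of f j]
  by (meson continuous_at_imp_continuous_on has_vector_derivative_continuous)

lemma nth_deriv_zero_on_open:
  assumes "open V" and "\<And>x. x \<in> V \<Longrightarrow> f x = 0" and "x \<in> V"
  shows "nth_deriv j f x = 0"
  using assms(3)
proof (induction j arbitrary: x)
  case (Suc j)
  have "(nth_deriv j f has_vector_derivative 0) (at x)"
    by (rule has_vector_derivative_transform_within_open[OF has_vector_derivative_const assms(1) Suc.prems, of 0])
       (use Suc.IH in simp)
  then show ?case
    by (simp add: nth_deriv_Suc vector_derivative_at)
qed (use assms in simp)

definition leibniz ::
  "(nat \<Rightarrow> real \<Rightarrow> complex) \<Rightarrow> (nat \<Rightarrow> real \<Rightarrow> complex) \<Rightarrow> nat \<Rightarrow> real \<Rightarrow> complex" where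
  "leibniz F G j x = (\<Sum>i\<le>j. of_nat (j choose i) * (F i x * G (j - i) x))"

lemma leibniz_0 [simp]: "leibniz F G 0 = (\<lambda>x. F 0 x * G 0 x)"
  by (simp add: leibniz_def fun_eq_iff)

lemma leibniz_sum_Suc:
  fixes a b :: "nat \<Rightarrow> complex"
  shows "(\<Sum>i\<le>j. of_nat (j choose i) * (a i * b (Suc (j - i)) + a (Suc i) * b (j - i))) =
    (\<Sum>i\<le>Suc j. of_nat (Suc j choose i) * (a i * b (Suc j - i)))"
proof -
  have "(\<Sum>i\<le>j. of_nat (j choose i) * (a i * b (Suc (j - i)))) =
      (\<Sum>i\<le>Suc j. of_nat (j choose i) * (a i * b (Suc j - i)))"
    by (simp add: Suc_diff_le)
  also have "\<dots> = a 0 * b (Suc j) + (\<Sum>i\<le>j. of_nat (j choose Suc i) * (a (Suc i) * b (j - i)))"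
    by (subst sum.atMost_Suc_shift) simp
  finally have 1: "(\<Sum>i\<le>j. of_nat (j choose i) * (a i * b (Suc (j - i)))) = \<dots>" .
  show ?thesis
    by (subst sum.atMost_Suc_shift)
       (simp add: distrib_left distrib_right sum.distrib 1)
qed

text \<open>
  Stated at a single point, because one of the factors will be the singular kernel $1 / (z - x)$,
  which is differentiable only away from $z$.
\<close>
lemma leibniz_has_vector_derivative:
  assumes "\<And>i. (F i has_vector_derivative F (Suc i) x) (at x)"
    and "\<And>i. (G i has_vector_derivative G (Suc i) x) (at x)"
  shows "(leibniz F G j has_vector_derivative leibniz F G (Suc j) x) (at x)"
proof -
  have "((\<lambda>x. \<Sum>i\<le>j. of_nat (j choose i) * (F i x * G (j - i) x)) has_vector_derivative
      (\<Sum>i\<le>j. of_nat (j choose i) * (F i x * G (Suc (j - i)) x + F (Suc i) x * G (j - i) x))) (at x)"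
    by (intro has_vector_derivative_sum has_vector_derivative_mult_right has_vector_derivative_mult assms)
  also have "(\<lambda>x. \<Sum>i\<le>j. of_nat (j choose i) * (F i x * G (j - i) x)) = leibniz F G j"
    by (simp add: leibniz_def fun_eq_iff)
  also have "(\<Sum>i\<le>j. of_nat (j choose i) * (F i x * G (Suc (j - i)) x + F (Suc i) x * G (j - i) x)) =
      leibniz F G (Suc j) x"
    unfolding leibniz_def by (rule leibniz_sum_Suc)
  finally show ?thesis .
qed

lemma deriv_seq_leibniz: "deriv_seq F \<Longrightarrow> deriv_seq G \<Longrightarrow> deriv_seq (leibniz F G)"
  by (simp add: deriv_seq_def leibniz_has_vector_derivative)

lemma nth_deriv_mult:
  assumes "smooth f" and "smooth g"
  shows "nth_deriv j (\<lambda>x. f x * g x) = leibniz (\<lambda>i. nth_deriv i f) (\<lambda>i. nth_deriv i g) j"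
  using nth_deriv_eq[OF deriv_seq_leibniz, of "\<lambda>i. nth_deriv i f" "\<lambda>i. nth_deriv i g" j] assms
  by (simp add: smooth_iff_deriv_seq)

lemma smooth_mult: "smooth f \<Longrightarrow> smooth g \<Longrightarrow> smooth (\<lambda>x. f x * g x)"
  using deriv_seq_smooth[OF deriv_seq_leibniz, of "\<lambda>i. nth_deriv i f" "\<lambda>i. nth_deriv i g"]
  by (simp add: smooth_iff_deriv_seq)

lemma norm_leibniz_le:
  assumes "\<And>i. cmod (F i x) \<le> A i * v" and "\<And>i. cmod (G i x) \<le> B i * w"
  shows "cmod (leibniz F G j x) \<le> (\<Sum>i\<le>j. real (j choose i) * (A i * B (j - i))) * (v * w)"
proof -
  have "cmod (leibniz F G j x) \<le> (\<Sum>i\<le>j. real (j choose i) * ((A i * v) * (B (j - i) * w)))"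
    unfolding leibniz_def
  proof (rule sum_norm_le)
    fix i
    have "cmod (F i x) * cmod (G (j - i) x) \<le> (A i * v) * (B (j - i) * w)"
      by (intro mult_mono assms order_trans[OF norm_ge_zero assms(1)] norm_ge_zero)
    then show "cmod (of_nat (j choose i) * (F i x * G (j - i) x)) \<le>
        real (j choose i) * ((A i * v) * (B (j - i) * w))"
      by (simp add: norm_mult mult_left_mono)
  qed
  then show ?thesis
    by (simp add: sum_distrib_left sum_distrib_right mult_ac)
qed

lemma deriv_seq_add:
  "deriv_seq F \<Longrightarrow> deriv_seq G \<Longrightarrow> deriv_seq (\<lambda>j x. F j x + G j x)"
  by (simp add: deriv_seq_def has_vector_derivative_add)

lemma deriv_seq_cmult: "deriv_seq F \<Longrightarrow> deriv_seq (\<lambda>j x. a * F j x)"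
  by (simp add: deriv_seq_def has_vector_derivative_mult_right)

lemma deriv_seq_affine:
  assumes "deriv_seq F"
  shows "deriv_seq (\<lambda>j x. complex_of_real (a ^ j) * F j (a * x + b))"
  unfolding deriv_seq_def
proof (intro allI)
  fix j x
  have "((\<lambda>x. a * x + b) has_vector_derivative a) (at x)"
    by (auto intro!: derivative_eq_intros)
  from vector_diff_chain_at[OF this, of "F j" "F (Suc j) (a * x + b)"] assms
  have "((\<lambda>x. F j (a * x + b)) has_vector_derivative a *\<^sub>R F (Suc j) (a * x + b)) (at x)"
    by (simp add: deriv_seq_def o_def)
  from has_vector_derivative_mult_right[OF this, of "complex_of_real (a ^ j)"]
  show "((\<lambda>x. complex_of_real (a ^ j) * F j (a * x + b)) has_vector_derivative
      complex_of_real (a ^ Suc j) * F (Suc j) (a * x + b)) (at x)"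
    by (simp add: scaleR_conv_of_real mult_ac)
qed

section \<open>The space of smooth functions of polynomial growth\<close>

lemma Oc_levelI:
  assumes "deriv_seq F" and "\<And>j. \<exists>B. \<forall>x. cmod (F j x) \<le> B * (1 + x\<^sup>2) ^ k"
  shows "F 0 \<in> Oc_level k"
  using assms by (simp add: Oc_level_def deriv_seq_smooth nth_deriv_eq)

lemma Oc_level_smooth: "f \<in> Oc_level k \<Longrightarrow> smooth f"
  by (simp add: Oc_level_def)

lemma Oc_level_bound:
  assumes "f \<in> Oc_level k"
  shows "\<exists>M. \<forall>j. 0 \<le> M j \<and> (\<forall>x. cmod (nth_deriv j f x) \<le> M j * (1 + x\<^sup>2) ^ k)"
proof -
  obtain M where M: "\<And>j x. cmod (nth_deriv j f x) \<le> M j * (1 + x\<^sup>2) ^ k"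
    using assms unfolding Oc_level_def by (simp; metis)
  have "0 \<le> M j" for j
    using order_trans[OF norm_ge_zero M[of j 0]] by simp
  then show ?thesis
    using M by blast
qed

lemma Oc_level_subset_Oc: "f \<in> Oc_level k \<Longrightarrow> f \<in> Oc"
  by (auto simp: Oc_def)

lemma Oc_level_mono:
  assumes "f \<in> Oc_level k" and "k \<le> l"
  shows "f \<in> Oc_level l"
proof -
  obtain M where M: "\<And>j. 0 \<le> M j" "\<And>j x. cmod (nth_deriv j f x) \<le> M j * (1 + x\<^sup>2) ^ k"
    using Oc_level_bound[OF assms(1)] by blast
  have "cmod (nth_deriv j f x) \<le> M j * (1 + x\<^sup>2) ^ l" for j x
    by (rule order_trans[OF M(2)]) (intro mult_left_mono power_increasing assms M; simp)
  then show ?thesis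
    using assms(1) unfolding Oc_level_def by blast
qed

lemma Oc_level_add:
  assumes "f \<in> Oc_level k" and "g \<in> Oc_level k"
  shows "(\<lambda>x. f x + g x) \<in> Oc_level k"
proof -
  obtain M N where M: "\<And>j x. cmod (nth_deriv j f x) \<le> M j * (1 + x\<^sup>2) ^ k"
    and N: "\<And>j x. cmod (nth_deriv j g x) \<le> N j * (1 + x\<^sup>2) ^ k"
    using Oc_level_bound[OF assms(1)] Oc_level_bound[OF assms(2)] by blast
  have "cmod (nth_deriv j f x + nth_deriv j g x) \<le> (M j + N j) * (1 + x\<^sup>2) ^ k" for j x
    using norm_triangle_mono[OF M N] by (simp add: distrib_right)
  then show ?thesis
    using Oc_levelI[of "\<lambda>j x. nth_deriv j f x + nth_deriv j g x" k] assms
    by (auto simp: deriv_seq_add Oc_level_smooth simp flip: smooth_iff_deriv_seq)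
qed

text \<open>
  By the Leibniz rule the growth exponents add, with one exponent valid for all derivatives.
\<close>
lemma Oc_level_mult:
  assumes "f \<in> Oc_level k" and "g \<in> Oc_level l"
  shows "(\<lambda>x. f x * g x) \<in> Oc_level (k + l)"
proof -
  obtain M N where M: "\<And>j x. cmod (nth_deriv j f x) \<le> M j * (1 + x\<^sup>2) ^ k"
    and N: "\<And>j x. cmod (nth_deriv j g x) \<le> N j * (1 + x\<^sup>2) ^ l"
    using Oc_level_bound[OF assms(1)] Oc_level_bound[OF assms(2)] by blast
  have "cmod (nth_deriv j (\<lambda>x. f x * g x) x) \<le>
      (\<Sum>i\<le>j. real (j choose i) * (M i * N (j - i))) * (1 + x\<^sup>2) ^ (k + l)" for j x
    unfolding nth_deriv_mult[OF assms[THEN Oc_level_smooth]] power_add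
    by (rule norm_leibniz_le; rule M N)
  then show ?thesis
    using assms by (auto simp: Oc_level_def smooth_mult)
qed

lemma const_Oc_level: "(\<lambda>_. a) \<in> Oc_level 0"
proof -
  let ?F = "\<lambda>j x. if j = 0 then a else 0 :: complex"
  have seq: "deriv_seq ?F"
    by (auto simp: deriv_seq_def)
  have bd: "\<exists>B. \<forall>x. cmod (?F j x) \<le> B * (1 + x\<^sup>2) ^ 0" for j
    by (auto intro: exI[of _ "cmod a"])
  from Oc_levelI[OF seq bd] show ?thesis by simp
qed

lemma of_real_Oc_level: "complex_of_real \<in> Oc_level 1"
proof -
  let ?F = "\<lambda>j x. if j = 0 then complex_of_real x else if j = 1 then 1 else 0"
  have lin: "\<bar>x\<bar> \<le> 1 + x\<^sup>2" for x :: real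
    using sum_power2_ge_zero[of "\<bar>x\<bar> - 1 / 2" 0] by (simp add: power2_eq_square algebra_simps)
  have "((\<lambda>x. complex_of_real x) has_vector_derivative 1) (at x)" for x
    using has_vector_derivative_of_real[OF DERIV_ident] by simp
  then have seq: "deriv_seq ?F"
    by (auto simp: deriv_seq_def)
  have bd: "\<exists>B. \<forall>x. cmod (?F j x) \<le> B * (1 + x\<^sup>2) ^ 1" for j
    using lin by (auto intro!: exI[of _ 1])
  from Oc_levelI[OF seq bd] show ?thesis by simp
qed

lemma power_Oc_level: "(\<lambda>x. complex_of_real x ^ n) \<in> Oc_level n"
proof (induction n)
  case 0
  show ?case using const_Oc_level[of 1] by simp
next
  case (Suc n)
  show ?case using Oc_level_mult[OF of_real_Oc_level Suc] by simp
qed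

lemma Oc_level_cmult: "f \<in> Oc_level k \<Longrightarrow> (\<lambda>x. c * f x) \<in> Oc_level k"
  using Oc_level_mult[OF const_Oc_level[of c], of f k] by simp

lemma Oc_level_diff: "f \<in> Oc_level k \<Longrightarrow> g \<in> Oc_level k \<Longrightarrow> (\<lambda>x. f x - g x) \<in> Oc_level k"
  using Oc_level_add[of f k "\<lambda>x. - 1 * g x"] Oc_level_cmult[of g k "- 1"] by simp

lemma Oc_smooth: "f \<in> Oc \<Longrightarrow> smooth f"
  by (auto simp: Oc_def Oc_level_smooth)

lemma Oc_add: "f \<in> Oc \<Longrightarrow> g \<in> Oc \<Longrightarrow> (\<lambda>x. f x + g x) \<in> Oc"
proof -
  assume "f \<in> Oc" "g \<in> Oc"
  then obtain k l where "f \<in> Oc_level k" "g \<in> Oc_level l"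
    by (auto simp: Oc_def)
  then have "f \<in> Oc_level (max k l)" "g \<in> Oc_level (max k l)"
    by (auto intro: Oc_level_mono)
  then show ?thesis
    using Oc_level_add Oc_level_subset_Oc by blast
qed

lemma Oc_mult: "f \<in> Oc \<Longrightarrow> g \<in> Oc \<Longrightarrow> (\<lambda>x. f x * g x) \<in> Oc"
  using Oc_level_mult by (auto simp: Oc_def; blast)

lemma const_Oc: "(\<lambda>_. a) \<in> Oc"
  using const_Oc_level by (rule Oc_level_subset_Oc)

lemma Oc_cmult: "f \<in> Oc \<Longrightarrow> (\<lambda>x. a * f x) \<in> Oc"
  using Oc_mult[OF const_Oc] by simp

lemma Oc_diff: "f \<in> Oc \<Longrightarrow> g \<in> Oc \<Longrightarrow> (\<lambda>x. f x - g x) \<in> Oc"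
  using Oc_add[of f "\<lambda>x. - 1 * g x"] Oc_cmult[of g "- 1"] by simp

lemma Oc_sum: "(\<And>i. i \<in> I \<Longrightarrow> f i \<in> Oc) \<Longrightarrow> (\<lambda>x. \<Sum>i\<in>I. f i x) \<in> Oc"
  by (induction I rule: infinite_finite_induct) (auto intro: const_Oc Oc_add)

lemma affine_Oc_level:
  assumes "f \<in> Oc_level 0"
  shows "(\<lambda>x. f (a * x + b)) \<in> Oc_level 0"
proof -
  obtain M where M: "\<And>j x. cmod (nth_deriv j f x) \<le> M j"
    using Oc_level_bound[OF assms] by auto
  have "cmod (complex_of_real (a ^ j) * nth_deriv j f (a * x + b)) \<le> \<bar>a\<bar> ^ j * M j" for j x
    using M by (simp add: norm_mult norm_power mult_left_mono)
  then show ?thesis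
    using Oc_levelI[of "\<lambda>j x. complex_of_real (a ^ j) * nth_deriv j f (a * x + b)" 0]
      deriv_seq_affine[of "\<lambda>j. nth_deriv j f" a b] Oc_level_smooth[OF assms]
    by (auto simp: smooth_iff_deriv_seq)
qed

section \<open>A smooth step function\<close>

text \<open>
  The functions $p(1/x) e^{-1/x}$, extended by zero to the left of the origin, form a family that
  is closed under differentiation.
\<close>
definition flat :: "real poly \<Rightarrow> real \<Rightarrow> real" where
  "flat p x = (if x > 0 then poly p (1 / x) * exp (- (1 / x)) else 0)"

lemma poly_div_exp_tendsto_0:
  fixes p :: "real poly"
  shows "((\<lambda>t. t ^ k * poly p t / exp t) \<longlongrightarrow> 0) at_top"
proof (induction p arbitrary: k)
  case 0
  show ?case by simp
next
  case (pCons a p)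
  have "((\<lambda>t. a * (t ^ k / exp t) + t ^ Suc k * poly p t / exp t) \<longlongrightarrow> a * 0 + 0) at_top"
    by (intro tendsto_add tendsto_mult_left tendsto_power_div_exp_0 pCons.IH)
  then show ?case
    by (simp add: algebra_simps add_divide_distrib)
qed

text \<open>
  At the origin the difference quotient is $t\, p(t) e^{-t}$ with $t = 1/x$, which tends to zero.
\<close>
lemma flat_has_derivative:
  "(flat p has_real_derivative flat ([:0, 0, 1:] * (p - pderiv p)) x) (at x)"
proof -
  let ?q = "[:0, 0, 1:] * (p - pderiv p)"
  consider "x > 0" | "x < 0" | "x = 0" by linarith
  then show ?thesis
  proof cases
    case 1
    have "((\<lambda>x. poly p (1 / x) * exp (- (1 / x))) has_real_derivative flat ?q x) (at x)"
      using 1 by (auto intro!: derivative_eq_intros simp: flat_def field_simps power2_eq_square)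
    then show ?thesis
      by (rule has_field_derivative_transform_within_open[of _ _ _ "{0<..}"])
         (use 1 in \<open>auto simp: flat_def\<close>)
  next
    case 2
    have "((\<lambda>x. 0) has_real_derivative flat ?q x) (at x)"
      using 2 by (simp add: flat_def)
    then show ?thesis
      by (rule has_field_derivative_transform_within_open[of _ _ _ "{..<0}"])
         (use 2 in \<open>auto simp: flat_def\<close>)
  next
    case 3
    have "((\<lambda>y. flat p y / y) \<longlongrightarrow> 0) (at_right 0)"
    proof -
      have "((\<lambda>y. inverse y ^ 1 * poly p (inverse y) / exp (inverse y)) \<longlongrightarrow> 0) (at_right (0::real))"
        by (rule filterlim_compose[OF poly_div_exp_tendsto_0 filterlim_inverse_at_top_right])
      then show ?thesis
        by (rule Lim_transform_eventually)
           (auto simp: eventually_at_filter flat_def exp_minus field_simps)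
    qed
    moreover have "((\<lambda>y. flat p y / y) \<longlongrightarrow> 0) (at_left 0)"
      by (rule Lim_transform_eventually[OF tendsto_const])
         (auto simp: eventually_at_filter flat_def)
    ultimately have "((\<lambda>y. flat p y / y) \<longlongrightarrow> 0) (at 0)"
      by (simp add: filterlim_split_at)
    then show ?thesis
      using 3 by (simp add: has_field_derivative_iff flat_def)
  qed
qed

lemma smooth_flat: "smooth (\<lambda>x. complex_of_real (flat p x))"
proof -
  define F where "F j x = complex_of_real (flat (((\<lambda>p. [:0, 0, 1:] * (p - pderiv p)) ^^ j) p) x)" for j x
  have "deriv_seq F"
    unfolding deriv_seq_def F_def funpow.simps o_apply
    by (intro allI has_vector_derivative_of_real flat_has_derivative)
  then have "smooth (F 0)"
    by (rule deriv_seq_smooth)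
  then show ?thesis
    by (simp add: F_def[abs_def])
qed

definition bump :: "real \<Rightarrow> real" where
  "bump x = flat 1 x * flat 1 (1 - x)"

lemma smooth_bump: "smooth (\<lambda>x. complex_of_real (bump x))"
proof -
  have "smooth (\<lambda>x. complex_of_real (flat 1 (- 1 * x + 1)))"
    using deriv_seq_smooth[OF deriv_seq_affine, of "\<lambda>j. nth_deriv j (\<lambda>x. complex_of_real (flat 1 x))" "- 1" 1]
      smooth_flat[of 1] by (simp add: smooth_iff_deriv_seq)
  from smooth_mult[OF smooth_flat[of 1] this] show ?thesis
    by (simp add: bump_def algebra_simps)
qed

lemma bump_nonneg: "bump x \<ge> 0"
  by (simp add: bump_def flat_def)

lemma bump_outside: "x \<notin> {0<..<1} \<Longrightarrow> bump x = 0"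
  by (auto simp: bump_def flat_def)

lemma continuous_on_bump: "continuous_on S bump"
proof -
  have "continuous_on S (\<lambda>x. Re (complex_of_real (bump x)))"
    using smooth_continuous_on[OF smooth_bump, of S 0] by (intro continuous_on_Re) simp
  then show ?thesis by simp
qed

text \<open>
  The base point lies strictly to the left of the support $[0, 1]$ of the bump, so that every
  $x \ge 0$ is interior to an interval on which the fundamental theorem of calculus applies.
\<close>
definition bump_integral :: "real \<Rightarrow> real" where
  "bump_integral x = integral {- 1..x} bump"

lemma bump_integral_nonpos:
  assumes "x \<le> 0"
  shows "bump_integral x = 0"
proof -
  have "integral {- 1..x} bump = integral {- 1..x} (\<lambda>_. 0)"
    by (rule integral_cong) (use assms in \<open>auto intro: bump_outside\<close>)
  then show ?thesis by (simp add: bump_integral_def)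
qed

lemma bump_integral_ge_1:
  assumes "x \<ge> 1"
  shows "bump_integral x = bump_integral 1"
proof -
  have "integral {1..x} bump = integral {1..x} (\<lambda>_. 0)"
    by (rule integral_cong) (auto intro: bump_outside)
  then show ?thesis
    using Henstock_Kurzweil_Integration.integral_combine[of "- 1" 1 x bump] assms
    by (simp add: bump_integral_def integrable_continuous_real continuous_on_bump)
qed

lemma bump_integral_1_nonzero: "bump_integral 1 \<noteq> 0"
proof
  assume "bump_integral 1 = 0"
  then have "bump (1 / 2) = 0"
    unfolding bump_integral_def
    using integral_eq_0_iff[OF continuous_on_bump, of "- 1" 1] bump_nonneg by auto
  then show False
    by (simp add: bump_def flat_def)
qed

lemma bump_integral_has_derivative: "(bump_integral has_real_derivative bump x) (at x)"
proof (cases "x < 0")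
  case True
  have "((\<lambda>_. 0) has_real_derivative bump x) (at x)"
    using True by (simp add: bump_outside)
  then show ?thesis
    by (rule has_field_derivative_transform_within_open[of _ _ _ "{..<0}"])
       (use True in \<open>auto simp: bump_integral_nonpos\<close>)
next
  case False
  have "(bump_integral has_vector_derivative bump x) (at x within {- 1..x + 1})"
    using integral_has_vector_derivative[OF continuous_on_bump, of x "- 1" "x + 1"] False
    by (simp add: bump_integral_def[abs_def])
  moreover have "at x within {- 1..x + 1} = at x"
    by (rule at_within_interior) (use False in auto)
  ultimately show ?thesis
    by (simp add: has_real_derivative_iff_has_vector_derivative)
qed

lemma continuous_bounded_outside:
  fixes f :: "real \<Rightarrow> complex"
  assumes "continuous_on UNIV f" and out: "\<And>x. x \<notin> {0..1} \<Longrightarrow> cmod (f x) \<le> K"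
  shows "\<exists>B. \<forall>x. cmod (f x) \<le> B"
proof -
  have "compact (f ` {0..1})"
    using assms(1) by (intro compact_continuous_image) (auto intro: continuous_on_subset)
  then obtain B where B: "\<And>x. x \<in> {0..1} \<Longrightarrow> cmod (f x) \<le> B"
    using compact_imp_bounded[of "f ` {0..1}"] unfolding bounded_iff by blast
  have "cmod (f x) \<le> max K B" for x
    using B[of x] out[of x] by (cases "x \<in> {0..1}") auto
  then show ?thesis by blast
qed

definition smooth_step :: "real \<Rightarrow> complex" where
  "smooth_step x = complex_of_real (bump_integral x / bump_integral 1)"

lemma smooth_step_nonpos: "x \<le> 0 \<Longrightarrow> smooth_step x = 0"
  by (simp add: smooth_step_def bump_integral_nonpos)

lemma smooth_step_ge_1: "x \<ge> 1 \<Longrightarrow> smooth_step x = 1"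
  using bump_integral_ge_1[of x] bump_integral_1_nonzero by (simp add: smooth_step_def)

text \<open>
  All derivatives of positive order are multiples of derivatives of the bump, hence continuous and
  zero outside the unit interval.
\<close>
lemma smooth_step_Oc_level: "smooth_step \<in> Oc_level 0"
proof -
  let ?b = "\<lambda>x. complex_of_real (bump x)"
  define c where "c = complex_of_real (1 / bump_integral 1)"
  define F where "F j = (case j of 0 \<Rightarrow> smooth_step | Suc i \<Rightarrow> (\<lambda>x. c * nth_deriv i ?b x))" for j
  have seq: "deriv_seq F"
    unfolding deriv_seq_def
  proof (intro allI)
    fix j x
    show "(F j has_vector_derivative F (Suc j) x) (at x)"
    proof (cases j)
      case 0
      have "((\<lambda>x. c * complex_of_real (bump_integral x)) has_vector_derivative c * ?b x) (at x)"
        by (intro has_vector_derivative_mult_right has_vector_derivative_of_real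
            bump_integral_has_derivative)
      then show ?thesis
        using 0 by (simp add: F_def c_def smooth_step_def[abs_def])
    next
      case (Suc i)
      then show ?thesis
        by (simp add: F_def has_vector_derivative_mult_right smooth_has_vector_derivative smooth_bump)
    qed
  qed
  have "\<exists>B. \<forall>x. cmod (F j x) \<le> B" for j
  proof (rule continuous_bounded_outside)
    show "continuous_on UNIV (F j)"
      using smooth_continuous_on[OF deriv_seq_smooth[OF seq], of UNIV j] nth_deriv_eq[OF seq] by simp
    fix x :: real assume x: "x \<notin> {0..1}"
    show "cmod (F j x) \<le> 1"
    proof (cases j)
      case 0
      then show ?thesis
        using x smooth_step_nonpos[of x] smooth_step_ge_1[of x] by (cases "x \<le> 0") (auto simp: F_def)
    next
      case (Suc i)
      have "nth_deriv i ?b x = 0"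
        by (rule nth_deriv_zero_on_open[of "- {0..1}"])
           (use x in \<open>auto intro!: bump_outside\<close>)
      then show ?thesis
        using Suc by (simp add: F_def)
    qed
  qed
  then have "F 0 \<in> Oc_level 0"
    using Oc_levelI[OF seq, of 0] by simp
  then show ?thesis
    by (simp add: F_def)
qed

text \<open>
  For fixed $s$ these are differences of translates of one function, which gives derivative bounds
  independent of $a$ and $b$, and consecutive ones telescope to a partition of unity.
\<close>
definition plateau :: "real \<Rightarrow> real \<Rightarrow> real \<Rightarrow> real \<Rightarrow> complex" where
  "plateau s a b x = smooth_step (s * x - a) - smooth_step (s * x - b)"

lemma plateau_outside: "a \<le> b \<Longrightarrow> s * x \<le> a \<or> s * x \<ge> b + 1 \<Longrightarrow> plateau s a b x = 0"
  by (auto simp: plateau_def smooth_step_nonpos smooth_step_ge_1)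

lemma plateau_inside: "a + 1 \<le> s * x \<Longrightarrow> s * x \<le> b \<Longrightarrow> plateau s a b x = 1"
  by (simp add: plateau_def smooth_step_nonpos smooth_step_ge_1)

lemma plateau_Oc_level: "plateau s a b \<in> Oc_level 0"
proof -
  have "(\<lambda>x. smooth_step (s * x + - a) - smooth_step (s * x + - b)) \<in> Oc_level 0"
    by (intro Oc_level_diff affine_Oc_level smooth_step_Oc_level)
  moreover have "plateau s a b = (\<lambda>x. smooth_step (s * x + - a) - smooth_step (s * x + - b))"
    by (simp add: plateau_def fun_eq_iff)
  ultimately show ?thesis by simp
qed

lemma closure_plateau:
  assumes "a \<le> b" and "s > 0"
  shows "closure {x. plateau s a b x \<noteq> 0} \<subseteq> {a / s..(b + 1) / s}"
proof (rule closure_minimal)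
  show "{x. plateau s a b x \<noteq> 0} \<subseteq> {a / s..(b + 1) / s}"
  proof
    fix x assume "x \<in> {x. plateau s a b x \<noteq> 0}"
    then have "\<not> (s * x \<le> a \<or> s * x \<ge> b + 1)"
      using plateau_outside[OF assms(1), of s x] by blast
    then show "x \<in> {a / s..(b + 1) / s}"
      using assms(2) by (simp add: pos_divide_le_eq pos_le_divide_eq mult.commute)
  qed
qed simp

text \<open>
  The bound is uniform in $n$ because the cutoffs differ only by translations of their two flanks.
\<close>
lemma cocutoff_bound:
  "\<exists>E. \<forall>j (n::nat) x. cmod (nth_deriv j (\<lambda>x. 1 - plateau 1 (- real n - 1) n x) x) \<le> E j"
proof -
  obtain M where M: "\<And>j. 0 \<le> M j" "\<And>j x. cmod (nth_deriv j smooth_step x) \<le> M j"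
    using Oc_level_bound[OF smooth_step_Oc_level] by auto
  have "cmod (nth_deriv j (\<lambda>x. 1 - plateau 1 (- real n - 1) n x) x) \<le> 1 + 2 * M j" for j n x
  proof -
    let ?A = "\<lambda>j x. (if j = 0 then 1 else 0 :: complex)"
    let ?B = "\<lambda>c j x. complex_of_real (1 ^ j) * nth_deriv j smooth_step (1 * x + c)"
    \<comment> \<open>the derivatives of $1 - (\sigma(x + n + 1) - \sigma(x - n))$, where $\sigma$ is the smooth step\<close>
    let ?F = "\<lambda>j x. (?A j x + - 1 * ?B (real n + 1) j x) + ?B (- real n) j x"
    have st: "deriv_seq (\<lambda>j. nth_deriv j smooth_step)"
      using Oc_level_smooth[OF smooth_step_Oc_level] by (simp add: smooth_iff_deriv_seq)
    have "deriv_seq ?F"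
      by (intro deriv_seq_add deriv_seq_cmult deriv_seq_affine st) (auto simp: deriv_seq_def)
    from nth_deriv_eq[OF this, of j]
    have eq: "nth_deriv j (\<lambda>x. 1 - plateau 1 (- real n - 1) n x) = ?F j"
      by (simp add: plateau_def algebra_simps)
    have "cmod (?F j x) \<le> (cmod (?A j x) + cmod (?B (real n + 1) j x)) + cmod (?B (- real n) j x)"
      by (rule order_trans[OF norm_triangle_ineq add_right_mono[OF order_trans[OF norm_triangle_ineq]]]) simp
    also have "\<dots> \<le> (1 + M j) + M j"
      using M(2)[of j] by (intro add_mono) auto
    finally show ?thesis
      by (simp add: eq)
  qed
  then show ?thesis
    by (intro exI[of _ "\<lambda>j. 1 + 2 * M j"]) blast
qed

section \<open>Distributions vanish away from their support\<close>

lemma Oc_dual_add: "Oc_dual T \<Longrightarrow> f \<in> Oc \<Longrightarrow> g \<in> Oc \<Longrightarrow> T (\<lambda>x. f x + g x) = T f + T g"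
  by (simp add: Oc_dual_def)

lemma Oc_dual_cmult: "Oc_dual T \<Longrightarrow> f \<in> Oc \<Longrightarrow> T (\<lambda>x. a * f x) = a * T f"
  by (simp add: Oc_dual_def)

lemma Oc_dual_zero: "Oc_dual T \<Longrightarrow> T (\<lambda>_. 0) = 0"
  using Oc_dual_cmult[of T "\<lambda>_. 0" 0] const_Oc by simp

lemma Oc_dual_diff: "Oc_dual T \<Longrightarrow> f \<in> Oc \<Longrightarrow> g \<in> Oc \<Longrightarrow> T (\<lambda>x. f x - g x) = T f - T g"
  using Oc_dual_add[of T f "\<lambda>x. - 1 * g x"] Oc_dual_cmult[of T g "- 1"] Oc_cmult[of g "- 1"] by simp

lemma Oc_dual_sum:
  assumes "Oc_dual T" and "\<And>i. i \<in> I \<Longrightarrow> f i \<in> Oc"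
  shows "T (\<lambda>x. \<Sum>i\<in>I. f i x) = (\<Sum>i\<in>I. T (f i))"
  using assms(2)
proof (induction I rule: infinite_finite_induct)
  case (insert i I)
  then show ?case
    using Oc_dual_add[OF assms(1), of "f i" "\<lambda>x. \<Sum>i\<in>I. f i x"] by (simp add: Oc_sum)
qed (simp_all add: Oc_dual_zero[OF assms(1)])

text \<open>
  If $x$ is in the support, then $\phi$ vanishes near $x$; if not, then $T$ does.
\<close>
lemma locally_zero_action:
  assumes T: "Oc_dual T" and \<phi>: "\<phi> \<in> Oc"
    and disj: "closure {x. \<phi> x \<noteq> 0} \<inter> distribution_support T = {}"
  shows "\<exists>V. open V \<and> x \<in> V \<and> (\<forall>\<theta>\<in>Oc. compact (closure {x. \<theta> x \<noteq> 0}) \<longrightarrow>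
    closure {x. \<theta> x \<noteq> 0} \<subseteq> V \<longrightarrow> T (\<lambda>x. \<theta> x * \<phi> x) = 0)"
proof (cases "x \<in> distribution_support T")
  case True
  let ?V = "- closure {x. \<phi> x \<noteq> 0}"
  have "T (\<lambda>x. \<theta> x * \<phi> x) = 0" if "closure {x. \<theta> x \<noteq> 0} \<subseteq> ?V" for \<theta>
  proof -
    have "\<theta> x * \<phi> x = 0" for x
      using that closure_subset[of "{x. \<theta> x \<noteq> 0}"] closure_subset[of "{x. \<phi> x \<noteq> 0}"] by auto
    then have "(\<lambda>x. \<theta> x * \<phi> x) = (\<lambda>_. 0)"
      by (rule ext)
    then show ?thesis
      using Oc_dual_zero[OF T] by (simp only:)
  qed
  then show ?thesis
    using True disj by (intro exI[of _ ?V]) auto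
next
  case False
  then obtain U where U: "open U" "x \<in> U" "\<And>\<phi>. \<phi> \<in> test_functions U \<Longrightarrow> T \<phi> = 0"
    by (auto simp: distribution_support_def)
  have "(\<lambda>x. \<theta> x * \<phi> x) \<in> test_functions U"
    if \<theta>: "\<theta> \<in> Oc" "compact (closure {x. \<theta> x \<noteq> 0})" "closure {x. \<theta> x \<noteq> 0} \<subseteq> U" for \<theta>
  proof -
    have sub: "closure {x. \<theta> x * \<phi> x \<noteq> 0} \<subseteq> closure {x. \<theta> x \<noteq> 0}"
      by (rule closure_mono) auto
    moreover have "compact (closure {x. \<theta> x * \<phi> x \<noteq> 0})"
      using compact_Int_closed[OF \<theta>(2) closed_closure] sub by (metis inf.absorb2)
    ultimately show ?thesis
      using \<theta> \<phi> by (auto simp: test_functions_def Oc_smooth smooth_mult)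
  qed
  then show ?thesis
    using U by (intro exI[of _ U]) blast
qed

text \<open>
  A Lebesgue number $e$ of the cover by the neighbourhoods of \<open>locally_zero_action\<close> tells how fine a
  partition of unity must be for each of its members to be supported in one of them.
\<close>
lemma Oc_dual_vanishes_compact:
  assumes T: "Oc_dual T" and \<phi>: "\<phi> \<in> Oc" and R: "\<And>x. \<bar>x\<bar> > real R \<Longrightarrow> \<phi> x = 0"
    and disj: "closure {x. \<phi> x \<noteq> 0} \<inter> distribution_support T = {}"
  shows "T \<phi> = 0"
proof -
  define C where "C = {V. open V \<and> (\<forall>\<theta>\<in>Oc. compact (closure {x. \<theta> x \<noteq> 0}) \<longrightarrow>
    closure {x. \<theta> x \<noteq> 0} \<subseteq> V \<longrightarrow> T (\<lambda>x. \<theta> x * \<phi> x) = 0)}"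
  have "{- real (R + 1)..real (R + 1)} \<subseteq> \<Union>C"
    using locally_zero_action[OF T \<phi> disj] unfolding C_def by blast
  then obtain e where e: "e > 0"
    "\<And>x. x \<in> {- real (R + 1)..real (R + 1)} \<Longrightarrow> \<exists>V\<in>C. ball x e \<subseteq> V"
    using Heine_Borel_lemma[OF compact_Icc, of "- real (R + 1)" "real (R + 1)" C] unfolding C_def
    by blast
  obtain N :: nat where N: "2 / e < real N"
    using reals_Archimedean2 by blast
  have N0: "0 < real N"
    using N e(1) by (meson divide_pos_pos less_trans zero_less_numeral)
  then have N1: "1 \<le> real N"
    by simp
  \<comment> \<open>The $2M$ plateaus of width $2/N$ start at $-M/N = -(R + 1)$ and sum to $1$ on $[-R, R]$.\<close>
  define M where "M = N * (R + 1)"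
  define \<psi> where "\<psi> k = plateau N (real k - M) (real k - M + 1)" for k :: nat
  have \<psi>_Oc: "\<psi> k \<in> Oc" for k
    unfolding \<psi>_def using plateau_Oc_level by (rule Oc_level_subset_Oc)
  have zero: "T (\<lambda>x. \<psi> k x * \<phi> x) = 0" if "k < 2 * M" for k
  proof -
    let ?p = "(real k - M) / N"
    have "real k \<le> 2 * real M"
      using that by simp
    moreover have "real M = real N * (real R + 1)"
      by (simp add: M_def algebra_simps)
    ultimately have "?p \<in> {- real (R + 1)..real (R + 1)}"
      using N0 by (simp add: field_simps)
    then obtain V where V: "V \<in> C" "ball ?p e \<subseteq> V"
      using e(2) by blast
    have cl: "closure {x. \<psi> k x \<noteq> 0} \<subseteq> {?p..(real k - M + 1 + 1) / N}"
      unfolding \<psi>_def by (rule closure_plateau) (use N0 in auto)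
    also have "\<dots> \<subseteq> ball ?p e"
    proof
      fix x assume "x \<in> {?p..(real k - M + 1 + 1) / N}"
      then have "0 \<le> x - ?p" "x - ?p \<le> 2 / N"
        by (auto simp: add_divide_distrib)
      moreover have "2 / N < e"
        using N N0 e(1) by (simp add: field_simps)
      ultimately show "x \<in> ball ?p e"
        by (simp add: dist_real_def)
    qed
    finally have "closure {x. \<psi> k x \<noteq> 0} \<subseteq> V"
      using V by blast
    moreover have "compact (closure {x. \<psi> k x \<noteq> 0})"
      using compact_Int_closed[OF compact_Icc closed_closure] cl by (metis inf.absorb2)
    ultimately show ?thesis
      using V(1) \<psi>_Oc unfolding C_def by blast
  qed
  have part: "(\<Sum>k<2 * M. \<psi> k x) * \<phi> x = \<phi> x" for x
  proof (cases "\<bar>x\<bar> > real R")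
    case False
    define f where "f k = smooth_step (real N * x - (real k - M))" for k
    have "(\<Sum>k<2 * M. \<psi> k x) = (\<Sum>k<2 * M. f k - f (Suc k))"
      by (simp add: \<psi>_def plateau_def f_def algebra_simps)
    also have "\<dots> = f 0 - f (2 * M)"
      by (rule sum_lessThan_telescope')
    also have "\<dots> = 1"
    proof -
      have "real N * (- real R) \<le> real N * x" "real N * x \<le> real N * real R"
        by (rule mult_left_mono; use False N0 in \<open>simp add: abs_le_iff not_less\<close>)+
      moreover have "real M = real N * real R + real N" "real (2 * M) = real M + real M" "real 0 = 0"
        by (simp_all add: M_def algebra_simps)
      ultimately have "real N * x - (real 0 - M) \<ge> 1" "real N * x - (real (2 * M) - M) \<le> 0"
        using N1 by linarith+
      then show ?thesis
        unfolding f_def by (simp only: smooth_step_ge_1 smooth_step_nonpos) simp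
    qed
    finally show ?thesis by simp
  qed (simp add: R)
  have "T \<phi> = T (\<lambda>x. \<Sum>k<2 * M. \<psi> k x * \<phi> x)"
    using part by (simp add: sum_distrib_right)
  also have "\<dots> = (\<Sum>k<2 * M. T (\<lambda>x. \<psi> k x * \<phi> x))"
    by (rule Oc_dual_sum[OF T]) (intro Oc_mult \<psi>_Oc \<phi>)
  also have "\<dots> = 0"
    using zero by simp
  finally show ?thesis .
qed

text \<open>
  The cut-off tail lives where $|x| \ge n$. There a bound of order $(1 + x^2)^k$ is a bound of
  order $(1 + x^2)^{k+1}$ with the constant divided by $1 + n^2$, and $T$ is continuous on the
  level $k + 1$ as well.
\<close>
lemma Oc_dual_tail_bound:
  assumes T: "Oc_dual T" and h: "h \<in> Oc"
  shows "\<exists>K. \<forall>n. cmod (T (\<lambda>x. (1 - plateau 1 (- real n - 1) n x) * h x)) \<le> K / (1 + (real n)\<^sup>2)"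
proof -
  obtain k where hk: "h \<in> Oc_level k"
    using h by (auto simp: Oc_def)
  obtain M where M: "\<And>j. 0 \<le> M j" "\<And>j x. cmod (nth_deriv j h x) \<le> M j * (1 + x\<^sup>2) ^ k"
    using Oc_level_bound[OF hk] by blast
  obtain E where E: "\<And>j n x. cmod (nth_deriv j (\<lambda>x. 1 - plateau 1 (- real n - 1) (real n) x) x) \<le> E j"
    using cocutoff_bound by blast
  have E0: "0 \<le> E j" for j
    using order_trans[OF norm_ge_zero E] .
  \<comment> \<open>continuity on the level above that of $h$ leaves room for a factor $1 / (1 + x^2)$\<close>
  obtain m B where B: "\<And>f c. f \<in> Oc_level (k + 1) \<Longrightarrow>
      (\<And>j x. j \<le> m \<Longrightarrow> cmod (nth_deriv j f x) \<le> c * (1 + x\<^sup>2) ^ (k + 1)) \<Longrightarrow> cmod (T f) \<le> B * c"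
    using T unfolding Oc_dual_def by metis
  define D where "D j = (\<Sum>i\<le>j. real (j choose i) * (E i * M (j - i)))" for j
  have D0: "0 \<le> D j" for j
    unfolding D_def by (intro sum_nonneg mult_nonneg_nonneg E0 M) simp
  define K where "K = (\<Sum>j\<le>m. D j)"
  have DK: "D j \<le> K" if "j \<le> m" for j
    unfolding K_def using that D0 by (intro member_le_sum) auto
  have "cmod (T (\<lambda>x. (1 - plateau 1 (- real n - 1) n x) * h x)) \<le> B * (K / (1 + (real n)\<^sup>2))" for n :: nat
  proof (rule B)
    let ?\<eta> = "\<lambda>x. 1 - plateau 1 (- real n - 1) n x"
    have \<eta>: "?\<eta> \<in> Oc_level 0"
      by (intro Oc_level_diff const_Oc_level plateau_Oc_level)
    show "(\<lambda>x. ?\<eta> x * h x) \<in> Oc_level (k + 1)"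
      using Oc_level_mono[OF Oc_level_mult[OF \<eta> hk], of "k + 1"] by simp
    fix j x assume j: "j \<le> m"
    show "cmod (nth_deriv j (\<lambda>x. ?\<eta> x * h x) x) \<le> K / (1 + (real n)\<^sup>2) * (1 + x\<^sup>2) ^ (k + 1)"
    proof (cases "\<bar>x\<bar> < n")
      case True
      have "nth_deriv j (\<lambda>x. ?\<eta> x * h x) x = 0"
        by (rule nth_deriv_zero_on_open[of "{- real n<..<n}"])
           (use True in \<open>auto simp: plateau_inside\<close>)
      then show ?thesis
        using DK[OF j] D0[of j] by simp
    next
      case False
      then have "(real n)\<^sup>2 \<le> x\<^sup>2"
        using power_mono[of "real n" "\<bar>x\<bar>" 2] by simp
      then have q: "1 \<le> (1 + x\<^sup>2) / (1 + (real n)\<^sup>2)"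
        by (simp add: field_simps add_pos_nonneg)
      have "cmod (nth_deriv j (\<lambda>x. ?\<eta> x * h x) x) \<le> D j * (1 * (1 + x\<^sup>2) ^ k)"
        unfolding nth_deriv_mult[OF Oc_level_smooth[OF \<eta>] Oc_level_smooth[OF hk]] D_def
        by (rule norm_leibniz_le) (use E M in auto)
      also have "\<dots> \<le> K * ((1 + x\<^sup>2) / (1 + (real n)\<^sup>2) * (1 + x\<^sup>2) ^ k)"
        using q DK[OF j] D0[of j] by (intro mult_mono) auto
      finally show ?thesis
        by (simp add: mult_ac)
    qed
  qed
  then show ?thesis
    by (intro exI[of _ "B * K"]) simp
qed

text \<open>
  Test functions only see compact sets, so $h$ is cut off at $|x| \approx n$; the compactly
  supported part is annihilated and the tail contributes $O(n^{-2})$.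
\<close>
lemma Oc_dual_vanishes:
  assumes T: "Oc_dual T" and h: "h \<in> Oc" and U: "open U" "distribution_support T \<subseteq> U"
    and hU: "\<And>x. x \<in> U \<Longrightarrow> h x = 0"
  shows "T h = 0"
proof -
  obtain K where K: "\<And>n. cmod (T (\<lambda>x. (1 - plateau 1 (- real n - 1) (real n) x) * h x)) \<le> K / (1 + (real n)\<^sup>2)"
    using Oc_dual_tail_bound[OF T h] by blast
  have "cmod (T h) \<le> K / (1 + (real n)\<^sup>2)" for n
  proof -
    let ?\<chi> = "plateau 1 (- real n - 1) n"
    have \<chi>: "?\<chi> \<in> Oc"
      using plateau_Oc_level by (rule Oc_level_subset_Oc)
    have out: "?\<chi> x = 0" if "\<bar>x\<bar> > real (n + 1)" for x
      by (rule plateau_outside) (use that in auto)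
    have "{x. ?\<chi> x * h x \<noteq> 0} \<subseteq> - U"
      using hU by auto
    then have "closure {x. ?\<chi> x * h x \<noteq> 0} \<subseteq> - U"
      using U(1) by (intro closure_minimal) auto
    then have "T (\<lambda>x. ?\<chi> x * h x) = 0"
      using U(2) by (intro Oc_dual_vanishes_compact[OF T Oc_mult[OF \<chi> h], of "n + 1"])
        (auto simp: out)
    moreover have "T (\<lambda>x. (1 - ?\<chi> x) * h x) = T h - T (\<lambda>x. ?\<chi> x * h x)"
      using Oc_dual_diff[OF T h Oc_mult[OF \<chi> h]] by (simp add: left_diff_distrib)
    ultimately show ?thesis
      using K[of n] by simp
  qed
  moreover have "(\<lambda>n. K / (1 + (real n)\<^sup>2)) \<longlonglongrightarrow> 0"
    by (intro tendsto_divide_0[OF tendsto_const] filterlim_at_top_imp_at_infinity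
        filterlim_tendsto_add_at_top[OF tendsto_const] filterlim_pow_at_top filterlim_real_sequentially) simp
  ultimately have "cmod (T h) \<le> 0"
    by (intro LIMSEQ_le_const) auto
  then show ?thesis by simp
qed

text \<open>
  The difference of two extensions vanishes near the support, so the extension used does not matter.
\<close>
lemma distribution_action_eq:
  assumes T: "Oc_dual T" and g: "g \<in> Oc" and U: "open U" "distribution_support T \<subseteq> U"
    and gf: "\<And>x. x \<in> U \<Longrightarrow> g x = f x"
  shows "distribution_action T f = T g"
  unfolding distribution_action_def
proof (rule the_equality)
  show "\<exists>g'\<in>Oc. (\<exists>U. open U \<and> distribution_support T \<subseteq> U \<and> (\<forall>x\<in>U. g' x = f x)) \<and> T g = T g'"
    using assms by blast
  fix c assume "\<exists>g'\<in>Oc. (\<exists>U. open U \<and> distribution_support T \<subseteq> U \<and> (\<forall>x\<in>U. g' x = f x)) \<and> c = T g'"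
  then obtain g' U' where g': "g' \<in> Oc" "open U'" "distribution_support T \<subseteq> U'"
    "\<And>x. x \<in> U' \<Longrightarrow> g' x = f x" "c = T g'"
    by blast
  have "T (\<lambda>x. g' x - g x) = 0"
    by (rule Oc_dual_vanishes[OF T, of _ "U \<inter> U'"]) (use assms g' in \<open>auto intro: Oc_diff\<close>)
  then show "c = T g"
    using Oc_dual_diff[OF T g'(1) g] g'(5) by simp
qed

section \<open>The Cauchy kernel and distributions\<close>

lemma cauchy_kernel_has_vector_derivative:
  assumes "z \<noteq> complex_of_real x"
  shows "((\<lambda>x. fact j / (z - complex_of_real x) ^ Suc j) has_vector_derivative
    fact (Suc j) / (z - complex_of_real x) ^ Suc (Suc j)) (at x)"
proof -
  have "((\<lambda>w. fact j / (z - w) ^ Suc j) has_field_derivative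
      fact (Suc j) / (z - complex_of_real x) ^ Suc (Suc j)) (at (complex_of_real x))"
  proof -
    have nz: "z - complex_of_real x \<noteq> 0" using assms by simp
    show ?thesis
      by (rule derivative_eq_intros refl | use nz in simp)+
  qed
  then show ?thesis
    by (rule has_vector_derivative_real_field)
qed

text \<open>
  Near $z$ all terms of the Leibniz sum vanish together with $\theta$, elsewhere the kernel has
  derivatives bounded by powers of $1/e$. For nonreal $z$ the hypothesis on $\theta$ is vacuous if
  $e$ does not exceed $|\mathrm{Im}\, z|$.
\<close>
lemma cauchy_kernel_cutoff_Oc_level:
  assumes \<theta>: "\<theta> \<in> Oc_level 0" and e: "e > 0"
    and zero: "\<And>x. cmod (z - complex_of_real x) < e \<Longrightarrow> \<theta> x = 0"
  shows "(\<lambda>x. \<theta> x / (z - complex_of_real x)) \<in> Oc_level 0"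
proof -
  let ?G = "\<lambda>j x. fact j / (z - complex_of_real x) ^ Suc j"
  let ?F = "leibniz (\<lambda>j. nth_deriv j \<theta>) ?G"
  let ?V = "{x. cmod (z - complex_of_real x) < e}"
  have V: "open ?V"
    by (intro open_Collect_less continuous_intros)
  have \<theta>0: "nth_deriv j \<theta> x = 0" if "x \<in> ?V" for j x
    by (rule nth_deriv_zero_on_open[OF V]) (use that zero in auto)
  then have F0: "?F j x = 0" if "x \<in> ?V" for j x
    using that by (simp add: leibniz_def)
  have seq: "deriv_seq ?F"
    unfolding deriv_seq_def
  proof (intro allI)
    fix j x
    show "(?F j has_vector_derivative ?F (Suc j) x) (at x)"
    proof (cases "x \<in> ?V")
      case True
      have "((\<lambda>_. 0) has_vector_derivative ?F (Suc j) x) (at x)"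
        using F0[OF True, of "Suc j"] by simp
      then show ?thesis
        by (rule has_vector_derivative_transform_within_open[OF _ V True]) (use F0 in simp)
    next
      case False
      then have "z \<noteq> complex_of_real x"
        using e by auto
      then show ?thesis
        by (intro leibniz_has_vector_derivative cauchy_kernel_has_vector_derivative
            smooth_has_vector_derivative Oc_level_smooth[OF \<theta>])
    qed
  qed
  obtain M where M: "\<And>j. 0 \<le> M j" "\<And>j x. cmod (nth_deriv j \<theta> x) \<le> M j"
    using Oc_level_bound[OF \<theta>] by auto
  have "cmod (?F j x) \<le> (\<Sum>i\<le>j. real (j choose i) * (M i * (fact (j - i) / e ^ Suc (j - i))))" for j x
  proof (cases "x \<in> ?V")
    case True
    have "0 \<le> (\<Sum>i\<le>j. real (j choose i) * (M i * (fact (j - i) / e ^ Suc (j - i))))"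
      using e by (intro sum_nonneg mult_nonneg_nonneg M) auto
    then show ?thesis
      unfolding F0[OF True] norm_zero .
  next
    case False
    then have "cmod (?G i x) \<le> fact i / e ^ Suc i" for i
      using e unfolding norm_divide norm_power
      by (auto intro!: divide_left_mono power_mono mult_pos_pos zero_less_power simp del: power_Suc)
    then have "cmod (?F j x) \<le> (\<Sum>i\<le>j. real (j choose i) * (M i * (fact (j - i) / e ^ Suc (j - i)))) * (1 * 1)"
      by (intro norm_leibniz_le) (use M in auto)
    then show ?thesis by simp
  qed
  then have "?F 0 \<in> Oc_level 0"
    using Oc_levelI[OF seq, of 0] by auto
  then show ?thesis by simp
qed

lemma open_compl_distribution_support: "open (- distribution_support T)"
proof (subst open_subopen, intro ballI)
  fix x assume "x \<in> - distribution_support T"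
  then obtain U where "open U" "x \<in> U" "\<forall>\<phi>\<in>test_functions U. T \<phi> = 0"
    unfolding distribution_support_def by blast
  then show "\<exists>U. open U \<and> x \<in> U \<and> U \<subseteq> - distribution_support T"
    unfolding distribution_support_def by (intro exI[of _ U]) blast
qed

text \<open>
  For real $z$ the kernel is multiplied by a function that is zero on the $\delta$-neighbourhood of
  $z$ and one outside the $2\delta$-neighbourhood, the latter being disjoint from the support.
\<close>
lemma cauchy_kernel_extension:
  assumes "z \<notin> complex_of_real ` distribution_support T"
  shows "\<exists>d\<in>Oc. \<exists>U. open U \<and> distribution_support T \<subseteq> U \<and>
    (\<forall>x\<in>U. z \<noteq> complex_of_real x \<and> d x = 1 / (z - complex_of_real x))"
proof (cases "Im z = 0")
  case False
  have "\<bar>Im z\<bar> \<le> cmod (z - complex_of_real x)" for x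
    using abs_Im_le_cmod[of "z - complex_of_real x"] by simp
  then have "(\<lambda>x. 1 / (z - complex_of_real x)) \<in> Oc_level 0"
    using False by (intro cauchy_kernel_cutoff_Oc_level[OF const_Oc_level, of "\<bar>Im z\<bar>"])
      (auto simp: not_less[symmetric])
  moreover have "z \<noteq> complex_of_real x" for x
    using False by auto
  ultimately show ?thesis
    using Oc_level_subset_Oc by (intro bexI[of _ "\<lambda>x. 1 / (z - complex_of_real x)"] exI[of _ UNIV]) auto
next
  case True
  define t where "t = Re z"
  have z: "z = complex_of_real t"
    using True by (simp add: t_def complex_eq_iff)
  then have "t \<in> - distribution_support T"
    using assms by auto
  then obtain r where r: "r > 0" "cball t r \<subseteq> - distribution_support T"
    using open_compl_distribution_support open_contains_cball by blast
  define \<delta> where "\<delta> = r / 2"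
  have \<delta>: "\<delta> > 0" "r = 2 * \<delta>"
    using r by (simp_all add: \<delta>_def)
  \<comment> \<open>The plateau equals $1$ for $|x - t| \le \delta$ and $0$ for $|x - t| \ge 2 \delta$.\<close>
  let ?\<theta> = "\<lambda>x. 1 - plateau (1 / \<delta>) (t / \<delta> - 2) (t / \<delta> + 1) x"
  have dist: "cmod (z - complex_of_real x) = \<bar>t - x\<bar>" for x
    by (simp add: z flip: of_real_diff)
  have "?\<theta> x = 0" if "cmod (z - complex_of_real x) < \<delta>" for x
  proof -
    have "\<bar>t - x\<bar> < \<delta>"
      using that by (simp only: dist)
    then have "(t - \<delta>) / \<delta> \<le> x / \<delta>" "x / \<delta> \<le> (t + \<delta>) / \<delta>"
      using \<delta>(1) by (auto intro!: divide_right_mono)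
    then have "plateau (1 / \<delta>) (t / \<delta> - 2) (t / \<delta> + 1) x = 1"
      using \<delta>(1) by (intro plateau_inside) (auto simp: diff_divide_distrib add_divide_distrib)
    then show ?thesis by simp
  qed
  then have "(\<lambda>x. ?\<theta> x / (z - complex_of_real x)) \<in> Oc_level 0"
    by (intro cauchy_kernel_cutoff_Oc_level[OF _ \<delta>(1)] Oc_level_diff const_Oc_level plateau_Oc_level)
  moreover have "?\<theta> x = 1" if "x \<notin> cball t r" for x
  proof -
    have "x \<le> t - 2 * \<delta> \<or> t + 2 * \<delta> \<le> x"
      using that \<delta> by (auto simp: dist_real_def)
    then have "1 / \<delta> * x \<le> t / \<delta> - 2 \<or> t / \<delta> + 1 + 1 \<le> 1 / \<delta> * x"
      using \<delta>(1) divide_right_mono[of x "t - 2 * \<delta>" \<delta>] divide_right_mono[of "t + 2 * \<delta>" x \<delta>]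
      by (auto simp: diff_divide_distrib add_divide_distrib)
    then have "plateau (1 / \<delta>) (t / \<delta> - 2) (t / \<delta> + 1) x = 0"
      by (intro plateau_outside) auto
    then show ?thesis by simp
  qed
  moreover have "z \<noteq> complex_of_real x" if "x \<notin> cball t r" for x
    using that r(1) by (auto simp: z)
  ultimately show ?thesis
    using r Oc_level_subset_Oc
    by (intro bexI[of _ "\<lambda>x. ?\<theta> x / (z - complex_of_real x)"] exI[of _ "- cball t r"]) auto
qed

text \<open>
  If $d$ extends $1 / (z - x)$, then $x^j d$ extends $x^j / (z - x)$, and linear
  relations between the functions near the support become linear relations in $\mathcal O_c$.
\<close>
lemma distribution_action:
  assumes adm: "admissible (Distribution T)" and z: "z \<notin> complex_of_real ` supp (Distribution T)"
  defines "A \<equiv> action (Distribution T)"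
  shows distribution_action_sum: "A (\<lambda>x. (\<Sum>j\<le>n. c j * complex_of_real x ^ j) / (z - complex_of_real x)) =
       (\<Sum>j\<le>n. c j * A (\<lambda>x. complex_of_real x ^ j / (z - complex_of_real x)))"
    and distribution_action_Suc: "A (\<lambda>x. complex_of_real x ^ (j + 1) / (z - complex_of_real x)) =
       z * A (\<lambda>x. complex_of_real x ^ j / (z - complex_of_real x)) - A (\<lambda>x. complex_of_real x ^ j)"
proof -
  have T: "Oc_dual T"
    using adm by simp
  obtain d U where d: "d \<in> Oc" and U: "open U" "distribution_support T \<subseteq> U"
    and zU: "\<And>x. x \<in> U \<Longrightarrow> z \<noteq> complex_of_real x"
    and dU: "\<And>x. x \<in> U \<Longrightarrow> d x = 1 / (z - complex_of_real x)"
    using cauchy_kernel_extension[of z T] z by auto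
  have A: "A f = T g" if "g \<in> Oc" "\<And>x. x \<in> U \<Longrightarrow> g x = f x" for f g
    using distribution_action_eq[OF T that(1) U that(2)] by (simp add: A_def)
  have p: "(\<lambda>x. complex_of_real x ^ j) \<in> Oc" for j
    using power_Oc_level by (rule Oc_level_subset_Oc)
  have pd: "(\<lambda>x. complex_of_real x ^ j * d x) \<in> Oc" for j
    by (intro Oc_mult p d)
  have R: "A (\<lambda>x. complex_of_real x ^ j / (z - complex_of_real x)) = T (\<lambda>x. complex_of_real x ^ j * d x)" for j
    by (rule A[OF pd]) (simp add: dU)
  have m: "A (\<lambda>x. complex_of_real x ^ j) = T (\<lambda>x. complex_of_real x ^ j)" for j
    by (rule A[OF p]) simp
  have "A (\<lambda>x. (\<Sum>j\<le>n. c j * complex_of_real x ^ j) / (z - complex_of_real x)) =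
      T (\<lambda>x. \<Sum>j\<le>n. c j * (complex_of_real x ^ j * d x))"
    by (rule A) (auto simp: dU sum_divide_distrib intro!: Oc_sum Oc_cmult pd)
  also have "\<dots> = (\<Sum>j\<le>n. c j * T (\<lambda>x. complex_of_real x ^ j * d x))"
    by (simp add: Oc_dual_sum[OF T] Oc_cmult pd Oc_dual_cmult[OF T])
  finally show "A (\<lambda>x. (\<Sum>j\<le>n. c j * complex_of_real x ^ j) / (z - complex_of_real x)) =
       (\<Sum>j\<le>n. c j * A (\<lambda>x. complex_of_real x ^ j / (z - complex_of_real x)))"
    by (simp add: R)
  have "A (\<lambda>x. complex_of_real x ^ (j + 1) / (z - complex_of_real x)) =
      T (\<lambda>x. z * (complex_of_real x ^ j * d x) - complex_of_real x ^ j)"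
  proof (rule A)
    show "(\<lambda>x. z * (complex_of_real x ^ j * d x) - complex_of_real x ^ j) \<in> Oc"
      by (intro Oc_diff Oc_cmult pd p)
    fix x assume "x \<in> U"
    then show "z * (complex_of_real x ^ j * d x) - complex_of_real x ^ j =
        complex_of_real x ^ (j + 1) / (z - complex_of_real x)"
      using zU[of x] by (simp add: dU field_simps)
  qed
  also have "\<dots> = z * T (\<lambda>x. complex_of_real x ^ j * d x) - T (\<lambda>x. complex_of_real x ^ j)"
    by (simp add: Oc_dual_diff[OF T] Oc_cmult pd p Oc_dual_cmult[OF T])
  finally show "A (\<lambda>x. complex_of_real x ^ (j + 1) / (z - complex_of_real x)) =
       z * A (\<lambda>x. complex_of_real x ^ j / (z - complex_of_real x)) - A (\<lambda>x. complex_of_real x ^ j)"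
    by (simp add: R m)
qed

section \<open>The recurrence relations\<close>

lemma action_cauchy:
  assumes adm: "admissible u" and z: "z \<notin> complex_of_real ` supp u"
  shows action_cauchy_sum:
      "action u (\<lambda>x. (\<Sum>j\<le>n. c j * complex_of_real x ^ j) / (z - complex_of_real x)) =
       (\<Sum>j\<le>n. c j * action u (\<lambda>x. complex_of_real x ^ j / (z - complex_of_real x)))"
    and action_cauchy_Suc:
      "action u (\<lambda>x. complex_of_real x ^ (j + 1) / (z - complex_of_real x)) =
       z * action u (\<lambda>x. complex_of_real x ^ j / (z - complex_of_real x)) -
       action u (\<lambda>x. complex_of_real x ^ j)"
proof -
  have "action u (\<lambda>x. (\<Sum>j\<le>n. c j * complex_of_real x ^ j) / (z - complex_of_real x)) =
       (\<Sum>j\<le>n. c j * action u (\<lambda>x. complex_of_real x ^ j / (z - complex_of_real x))) \<and>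
      action u (\<lambda>x. complex_of_real x ^ (j + 1) / (z - complex_of_real x)) =
       z * action u (\<lambda>x. complex_of_real x ^ j / (z - complex_of_real x)) -
       action u (\<lambda>x. complex_of_real x ^ j)"
  proof (cases u)
    case (Measure \<mu>)
    show ?thesis
      using measure_action[of \<mu> z] adm z unfolding Measure by blast
  next
    case (Distribution T)
    show ?thesis
      using distribution_action[of T z] adm z unfolding Distribution by blast
  qed
  then show "action u (\<lambda>x. (\<Sum>j\<le>n. c j * complex_of_real x ^ j) / (z - complex_of_real x)) =
       (\<Sum>j\<le>n. c j * action u (\<lambda>x. complex_of_real x ^ j / (z - complex_of_real x)))"
    "action u (\<lambda>x. complex_of_real x ^ (j + 1) / (z - complex_of_real x)) =
       z * action u (\<lambda>x. complex_of_real x ^ j / (z - complex_of_real x)) -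
       action u (\<lambda>x. complex_of_real x ^ j)"
    by auto
qed

theorem proposition16:
  fixes u :: functional
  assumes "admissible u" and "quasi_definite u"
  shows "(\<forall>x. jacobi u \<odot>\<^sub>v orth_poly u x = (\<lambda>k. x * orth_poly u x k)) \<and>
    (\<forall>x. x \<notin> complex_of_real ` supp u \<longrightarrow>
           jacobi u \<odot>\<^sub>v second_kind u x = (\<lambda>k. x * second_kind u x k - H_diag u 0 * e0 k)) \<and>
    (\<forall>k\<ge>1. \<forall>x.
           H_diag u k / H_diag u (k - 1) * orth_poly u x (k - 1)
           + (S_mat u k (k - 1) - S_mat u (k + 1) k) * orth_poly u x k
           + orth_poly u x (k + 1) = x * orth_poly u x k) \<and>
    (\<forall>k\<ge>1. \<forall>x. x \<notin> complex_of_real ` supp u \<longrightarrow>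
           H_diag u k / H_diag u (k - 1) * second_kind u x (k - 1)
           + (S_mat u k (k - 1) - S_mat u (k + 1) k) * second_kind u x k
           + second_kind u x (k + 1) = x * second_kind u x k)"
proof -
  define R :: "complex \<Rightarrow> ivec"
    where "R z j = action u (\<lambda>x. complex_of_real x ^ j / (z - complex_of_real x))" for z j
  have lin: "action u (\<lambda>x. (\<Sum>j\<le>n. c j * complex_of_real x ^ j) / (z - complex_of_real x)) =
      (\<Sum>j\<le>n. c j * R z j)" if "z \<notin> complex_of_real ` supp u" for z c and n :: nat
    unfolding R_def by (rule action_cauchy_sum[OF assms(1) that])
  have rec: "R z (j + 1) = z * R z j - action u (\<lambda>x. complex_of_real x ^ j)"
    if "z \<notin> complex_of_real ` supp u" for z j
    unfolding R_def by (rule action_cauchy_Suc[OF assms(1) that])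
  let ?S = "S_mat u" and ?h = "H_diag u" and ?G = "moment_matrix u"
  define m where "m j = action u (\<lambda>x. complex_of_real x ^ j)" for j
  have gb: "gauss_borel ?G ?S ?h" and h: "\<And>n. ?h n \<noteq> 0"
    using gauss_borel_factors[OF assms(2)] by auto
  have hankel: "?G i j = m (i + j)" for i j
    by (simp add: moment_matrix_def m_def)
  have S: "lower_unitriangular ?S"
    using gb by (simp add: gauss_borel_def)
  \<comment> \<open>column $0$ of $S G = H S^{-\top}$\<close>
  have GS: "(?S \<odot>\<^sub>v m) k = ?h 0 * e0 k" for k
  proof -
    have sym: "?G i j = ?G j i" for i j
      by (simp add: hankel add.commute)
    have "(?S \<odot>\<^sub>v m) k = (?S \<odot> ?G) k 0"
      using hankel by (simp add: imat_vec_def imat_mult_def)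
    then show ?thesis
      using gb[unfolded gauss_borel_iff_upper[where G = ?G, OF S sym], rule_format, of 0 k]
      by (auto simp: e0_def)
  qed
  have P: "jacobi u \<odot>\<^sub>v orth_poly u x = (\<lambda>k. x * orth_poly u x k)" for x
  proof
    fix k
    have "jacobi u \<odot>\<^sub>v orth_poly u x = ?S \<odot>\<^sub>v (shift \<odot>\<^sub>v monomials x)"
      by (simp add: jacobi_def orth_poly_def jacobi_matrix_mult[OF S])
    then show "(jacobi u \<odot>\<^sub>v orth_poly u x) k = x * orth_poly u x k"
      by (simp add: orth_poly_def lower_unitriangular_vec_eq_sum[OF S] shift_vec monomials_def
          sum_distrib_left mult_ac)
  qed
  have C: "jacobi u \<odot>\<^sub>v second_kind u z = (\<lambda>k. z * second_kind u z k - ?h 0 * e0 k)"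
    if z: "z \<notin> complex_of_real ` supp u" for z
  proof
    fix k
    have CR: "second_kind u z = ?S \<odot>\<^sub>v R z"
    proof
      fix k show "second_kind u z k = (?S \<odot>\<^sub>v R z) k"
        using lin[OF z, of "?S k" k]
        by (simp add: second_kind_def orth_poly_def lower_unitriangular_vec_eq_sum[OF S] monomials_def)
    qed
    have "jacobi u \<odot>\<^sub>v second_kind u z = ?S \<odot>\<^sub>v (shift \<odot>\<^sub>v R z)"
      by (simp add: jacobi_def CR jacobi_matrix_mult[OF S])
    then have "(jacobi u \<odot>\<^sub>v second_kind u z) k = z * second_kind u z k - (?S \<odot>\<^sub>v m) k"
      by (simp add: CR lower_unitriangular_vec_eq_sum[OF S] shift_vec rec[OF z, simplified] m_def
          sum_distrib_left sum_subtractf algebra_simps)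
    then show "(jacobi u \<odot>\<^sub>v second_kind u z) k = z * second_kind u z k - ?h 0 * e0 k"
      by (simp add: GS)
  qed
  have row: "?h k / ?h (k - 1) * v (k - 1) + (?S k (k - 1) - ?S (k + 1) k) * v k + v (k + 1) =
      (jacobi u \<odot>\<^sub>v v) k" if "k \<ge> 1" for k v
    using jacobi_matrix_vec[where G = ?G and m = m, OF gb h hankel that] by (simp add: jacobi_def)
  show ?thesis
  proof (intro conjI allI impI)
    fix k :: nat and x assume k: "k \<ge> 1"
    show "?h k / ?h (k - 1) * orth_poly u x (k - 1) + (?S k (k - 1) - ?S (k + 1) k) * orth_poly u x k
        + orth_poly u x (k + 1) = x * orth_poly u x k"
      unfolding row[OF k] P ..
    assume "x \<notin> complex_of_real ` supp u"
    then show "?h k / ?h (k - 1) * second_kind u x (k - 1)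
        + (?S k (k - 1) - ?S (k + 1) k) * second_kind u x k
        + second_kind u x (k + 1) = x * second_kind u x k"
      unfolding row[OF k] using C k by (simp add: e0_def)
  qed (use P C in simp_all)
qed

end
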